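(* Let $G$ be a finite group, let $H \leq G$ be a subgroup, and let $F$ be a field whose characteristic does not divide $|G|$. Suppose that $H$ has a faithful irreducible representation $\rho$ over $F$. Then one of the irreducible constituents of the induced representation $\operatorname{Ind}_H^G(\rho)$ is center-preserving on $H$.
   Context: All representations are finite-dimensional linear representations over $F$. For a group $L$, $\mathrm{Z}(L)$ denotes its center. For a group homomorphism $\sigma\colon G\to L$ (in particular a representation), the center of $\sigma$ is $\mathrm{Z}(\sigma)=\sigma^{-1}\big(\mathrm{Z}(\sigma(G))\big)$, the preimage of the center of the image. For a subgroup $H\leq G$, $\sigma$ is called center-preserving on $H$ if $\mathrm{Z}(\sigma)\cap H\leq \mathrm{Z}(G)$. *)

theory Defs
  imports
    Complex_Main
    "HOL-Algebra.Coset"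
    "HOL-Algebra.Bij"
    "HOL-Library.Function_Algebras"
begin

section \<open>Centers\<close>

definition group_center :: "('a, 'b) monoid_scheme \<Rightarrow> 'a set" where
  "group_center L = {z \<in> carrier L. \<forall>x\<in>carrier L. z \<otimes>\<^bsub>L\<^esub> x = x \<otimes>\<^bsub>L\<^esub> z}"

definition hom_center ::
  "('a, 'b) monoid_scheme \<Rightarrow> ('c, 'd) monoid_scheme \<Rightarrow> ('a \<Rightarrow> 'c) \<Rightarrow> 'a set" where
  "hom_center G L \<sigma> =
     {g \<in> carrier G. \<sigma> g \<in> group_center (L\<lparr>carrier := \<sigma> ` carrier G\<rparr>)}"

definition center_preserving_on ::
  "('a, 'b) monoid_scheme \<Rightarrow> ('c, 'd) monoid_scheme \<Rightarrow> ('a \<Rightarrow> 'c) \<Rightarrow> 'a set \<Rightarrow> bool" where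
  "center_preserving_on G L \<sigma> H \<longleftrightarrow> hom_center G L \<sigma> \<inter> H \<subseteq> group_center G"


section \<open>Finite-dimensional linear representations\<close>

text \<open>
  A representation space is a finite-dimensional subspace \<open>V\<close> of an ambient vector space, which
  is a type \<open>'v\<close> with scalar multiplication \<open>s\<close>; the ambient space itself need not be
  finite-dimensional. As in \<^const>\<open>BijGroup\<close>, the elements of \<open>GL s V\<close> are
  extensional, that is, \<^const>\<open>undefined\<close> outside \<open>V\<close>, so that equality in \<open>GL s V\<close> is equality of
  maps on \<open>V\<close>.
\<close>

definition linear_on ::
  "('f::field \<Rightarrow> 'v::ab_group_add \<Rightarrow> 'v) \<Rightarrow> 'v set \<Rightarrow> ('v \<Rightarrow> 'v) \<Rightarrow> bool" where
  "linear_on s V f \<longleftrightarrow>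
     (\<forall>x\<in>V. \<forall>y\<in>V. f (x + y) = f x + f y) \<and> (\<forall>c. \<forall>x\<in>V. f (s c x) = s c (f x))"

definition GL ::
  "('f::field \<Rightarrow> 'v::ab_group_add \<Rightarrow> 'v) \<Rightarrow> 'v set \<Rightarrow> ('v \<Rightarrow> 'v) monoid" where
  "GL s V = BijGroup V\<lparr>carrier := {f \<in> Bij V. linear_on s V f}\<rparr>"

lemma linear_onD:
  assumes "linear_on s V f" "x \<in> V"
  shows "y \<in> V \<Longrightarrow> f (x + y) = f x + f y" "f (s c x) = s c (f x)"
  using assms by (auto simp: linear_on_def)

lemma group_GL:
  fixes s :: "'f::field \<Rightarrow> 'v::ab_group_add \<Rightarrow> 'v"
  assumes "vector_space s" "module.subspace s V"
  shows "group (GL s V)"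
proof -
  interpret vector_space s by fact
  interpret B: group "BijGroup V" by (rule group_BijGroup)
  have add: "x + y \<in> V" and scale: "s c x \<in> V" if "x \<in> V" "y \<in> V" for x y c
    using that assms(2) by (auto intro: subspace_add subspace_scale)
  have "subgroup {f \<in> Bij V. linear_on s V f} (BijGroup V)"
  proof (rule B.subgroupI)
    show "{f \<in> Bij V. linear_on s V f} \<subseteq> carrier (BijGroup V)"
      by (auto simp: BijGroup_def)
    have "restrict (\<lambda>x. x) V \<in> {f \<in> Bij V. linear_on s V f}"
      by (auto simp: id_Bij linear_on_def add scale)
    then show "{f \<in> Bij V. linear_on s V f} \<noteq> {}" by blast
  next
    fix f assume f: "f \<in> {f \<in> Bij V. linear_on s V f}"
    then have fB: "f \<in> Bij V" and lin: "linear_on s V f" by auto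
    define k where "k = inv_into V f"
    have k: "k x \<in> V" "f (k x) = x" if "x \<in> V" for x
      using fB that Bij_inv_into_mem[OF fB that]
      by (auto simp: k_def Bij_def bij_betw_def f_inv_into_f)
    have kf: "k (f x) = x" if "x \<in> V" for x
      using fB that by (auto simp: k_def Bij_def bij_betw_def)
    have "k (x + y) = k x + k y" if "x \<in> V" "y \<in> V" for x y
      using kf[OF add[OF k(1)[OF that(1)] k(1)[OF that(2)]]] linear_onD(1)[OF lin k(1)[OF that(1)] k(1)[OF that(2)]]
        k(2) that by simp
    moreover have "k (s c x) = s c (k x)" if "x \<in> V" for x c
      using kf[OF scale[OF k(1)[OF that] k(1)[OF that]], of c] linear_onD(2)[OF lin k(1)[OF that], of c]
        k(2) that by simp
    ultimately have "linear_on s V (restrict k V)"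
      by (auto simp: linear_on_def add scale)
    then show "inv\<^bsub>BijGroup V\<^esub> f \<in> {f \<in> Bij V. linear_on s V f}"
      using fB by (simp add: inv_BijGroup k_def restrict_inv_into_Bij)
  next
    fix f f' assume f: "f \<in> {f \<in> Bij V. linear_on s V f}" "f' \<in> {f \<in> Bij V. linear_on s V f}"
    then have "linear_on s V (compose V f f')"
      using Bij_imp_funcset[of f' V] by (auto simp: linear_on_def compose_def add scale Pi_iff)
    then show "f \<otimes>\<^bsub>BijGroup V\<^esub> f' \<in> {f \<in> Bij V. linear_on s V f}"
      using f by (simp add: BijGroup_def compose_Bij)
  qed
  then show ?thesis
    unfolding GL_def by (rule subgroup.subgroup_is_group[OF _ group_BijGroup])
qed

locale linear_rep = vector_space s + group G
  for s :: "'f::field \<Rightarrow> 'v::ab_group_add \<Rightarrow> 'v"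
    and G :: "('g, 'b) monoid_scheme" (structure)
    and V :: "'v set"
    and \<sigma> :: "'g \<Rightarrow> 'v \<Rightarrow> 'v" +
  assumes finite_dim: "\<exists>B. finite B \<and> V = span B"
    and hom_GL: "\<sigma> \<in> hom G (GL s V)"

definition faithful_rep :: "('g, 'b) monoid_scheme \<Rightarrow> ('g \<Rightarrow> 'v \<Rightarrow> 'v) \<Rightarrow> bool" where
  "faithful_rep G \<sigma> \<longleftrightarrow> inj_on \<sigma> (carrier G)"

definition invariant_subspace ::
  "('f::field \<Rightarrow> 'v::ab_group_add \<Rightarrow> 'v) \<Rightarrow> ('g, 'b) monoid_scheme \<Rightarrow> 'v set \<Rightarrow>
     ('g \<Rightarrow> 'v \<Rightarrow> 'v) \<Rightarrow> 'v set \<Rightarrow> bool" where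
  "invariant_subspace s G V \<sigma> W \<longleftrightarrow>
     W \<subseteq> V \<and> module.subspace s W \<and> (\<forall>g\<in>carrier G. \<forall>w\<in>W. \<sigma> g w \<in> W)"

definition irreducible_rep ::
  "('f::field \<Rightarrow> 'v::ab_group_add \<Rightarrow> 'v) \<Rightarrow> ('g, 'b) monoid_scheme \<Rightarrow> 'v set \<Rightarrow>
     ('g \<Rightarrow> 'v \<Rightarrow> 'v) \<Rightarrow> bool" where
  "irreducible_rep s G V \<sigma> \<longleftrightarrow>
     linear_rep s G V \<sigma> \<and> V \<noteq> {0} \<and>
     (\<forall>W. invariant_subspace s G V \<sigma> W \<longrightarrow> W = {0} \<or> W = V)"

definition subrep :: "('g \<Rightarrow> 'v \<Rightarrow> 'v) \<Rightarrow> 'v set \<Rightarrow> 'g \<Rightarrow> 'v \<Rightarrow> 'v" where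
  "subrep \<sigma> W = (\<lambda>g. restrict (\<sigma> g) W)"

text \<open>
  \<open>irreducible_constituent s G V \<sigma> W\<close>: the representation \<open>subrep \<sigma> W\<close> of \<open>G\<close> on \<open>W\<close> is
  an irreducible direct summand of the representation \<open>\<sigma>\<close> on \<open>V\<close>. If the
  characteristic does not divide the order of \<open>G\<close>, then \<open>\<sigma>\<close> is completely reducible, and
  up to isomorphism these are all the composition factors of \<open>\<sigma>\<close>.
\<close>

definition irreducible_constituent ::
  "('f::field \<Rightarrow> 'v::ab_group_add \<Rightarrow> 'v) \<Rightarrow> ('g, 'b) monoid_scheme \<Rightarrow> 'v set \<Rightarrow>
     ('g \<Rightarrow> 'v \<Rightarrow> 'v) \<Rightarrow> 'v set \<Rightarrow> bool" where
  "irreducible_constituent s G V \<sigma> W \<longleftrightarrow>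
     invariant_subspace s G V \<sigma> W \<and> irreducible_rep s G W (subrep \<sigma> W) \<and>
     (\<exists>W'. invariant_subspace s G V \<sigma> W' \<and> W \<inter> W' = {0} \<and>
           V = {w + w' | w w'. w \<in> W \<and> w' \<in> W'})"


section \<open>Induced representations\<close>

definition fun_scale :: "('f \<Rightarrow> 'v \<Rightarrow> 'v) \<Rightarrow> 'f \<Rightarrow> ('g \<Rightarrow> 'v) \<Rightarrow> 'g \<Rightarrow> 'v" where
  "fun_scale s c f = (\<lambda>x. s c (f x))"

text \<open>
  The induced representation is realised on the space of functions \<open>f\<close> from \<open>G\<close> to \<open>V\<close> with
  \<open>f (x h) = \<rho> h\<^sup>-\<^sup>1 (f x)\<close> for \<open>h\<close> in \<open>H\<close>, on which \<open>G\<close> acts by left translation. Since \<open>H\<close> has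
  finite index, this is the tensor product of the group algebra of \<open>G\<close> with \<open>V\<close> over the group
  algebra of \<open>H\<close>: the function \<open>f\<close> corresponds to the sum of \<open>x \<otimes> f x\<close> over representatives
  \<open>x\<close> of the left cosets of \<open>H\<close>. Functions on \<open>carrier G\<close> are extended by \<open>0\<close> (rather than
  by \<^const>\<open>undefined\<close>), which makes them a subspace of \<open>'g \<Rightarrow> 'v\<close>.
\<close>

definition induced_space ::
  "('g, 'b) monoid_scheme \<Rightarrow> 'g set \<Rightarrow> 'v::zero set \<Rightarrow> ('g \<Rightarrow> 'v \<Rightarrow> 'v) \<Rightarrow> ('g \<Rightarrow> 'v) set" where
  "induced_space G H V \<rho> =
     {f. (\<forall>x\<in>carrier G. f x \<in> V) \<and> (\<forall>x. x \<notin> carrier G \<longrightarrow> f x = 0) \<and>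
         (\<forall>x\<in>carrier G. \<forall>h\<in>H. f (x \<otimes>\<^bsub>G\<^esub> h) = \<rho> (inv\<^bsub>G\<^esub> h) (f x))}"

definition induced_rep ::
  "('g, 'b) monoid_scheme \<Rightarrow> 'g set \<Rightarrow> 'v::zero set \<Rightarrow> ('g \<Rightarrow> 'v \<Rightarrow> 'v) \<Rightarrow>
     'g \<Rightarrow> ('g \<Rightarrow> 'v) \<Rightarrow> 'g \<Rightarrow> 'v" where
  "induced_rep G H V \<rho> g =
     (\<lambda>f\<in>induced_space G H V \<rho>.
        \<lambda>x. if x \<in> carrier G then f (inv\<^bsub>G\<^esub> g \<otimes>\<^bsub>G\<^esub> x) else 0)"

lemma vector_space_fun_scale: "vector_space s \<Longrightarrow> vector_space (fun_scale s)"
  unfolding vector_space_def by (simp add: fun_scale_def fun_eq_iff)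

text \<open>The induced representation really is a finite-dimensional representation of \<open>G\<close>.\<close>

lemma linear_rep_induced:
  fixes G :: "('g, 'b) monoid_scheme" and s :: "'f::field \<Rightarrow> 'v::ab_group_add \<Rightarrow> 'v"
  assumes G: "group G" and fin: "finite (carrier G)" and H: "subgroup H G"
    and rep: "linear_rep s (G\<lparr>carrier := H\<rparr>) V \<rho>"
  shows "linear_rep (fun_scale s) G (induced_space G H V \<rho>) (induced_rep G H V \<rho>)"
proof -
  interpret G: group G by fact
  interpret H: subgroup H G by fact
  interpret R: linear_rep s "G\<lparr>carrier := H\<rparr>" V \<rho> by fact
  interpret F: vector_space "fun_scale s"
    by (rule vector_space_fun_scale) (rule R.vector_space_axioms)
  let ?U = "induced_space G H V \<rho>" and ?t = "induced_rep G H V \<rho>"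
  obtain B where B: "finite B" "V = R.span B" using R.finite_dim by blast
  have V: "R.subspace V" by (simp add: B)
  have lin: "linear_on s V (\<rho> h)" if "h \<in> H" for h
    using R.hom_GL that by (auto simp: hom_def GL_def)
  have rinv: "inv\<^bsub>G\<^esub> h \<in> H" if "h \<in> H" for h using that by simp
  have sub: "F.subspace ?U"
  proof (rule F.subspaceI)
    have "\<rho> h 0 = 0" if "h \<in> H" for h
      using linear_onD(2)[OF lin[OF that] R.subspace_0[OF V], of 0] by simp
    then show "0 \<in> ?U" using R.subspace_0[OF V] by (auto simp: induced_space_def)
    show "f + k \<in> ?U" if "f \<in> ?U" "k \<in> ?U" for f k
      using that linear_onD(1)[OF lin[OF rinv]] R.subspace_add[OF V]
      by (auto simp: induced_space_def)
    show "fun_scale s c f \<in> ?U" if "f \<in> ?U" for f c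
      using that linear_onD(2)[OF lin[OF rinv]] R.subspace_scale[OF V]
      by (auto simp: induced_space_def fun_scale_def)
  qed
  define d where "d = (\<lambda>x::'g. \<lambda>v::'v. \<lambda>y. if y = x then v else 0)"
  define D where "D = (\<lambda>(x, b). d x b) ` (carrier G \<times> B)"
  have finD: "finite D" using fin B by (simp add: D_def)
  have dspan: "d x v \<in> F.span D" if "x \<in> carrier G" "v \<in> V" for x v
    using that(2) unfolding B(2)
  proof (induction rule: R.span_induct_alt)
    case base
    have "d x 0 = 0" by (auto simp: d_def)
    then show ?case using F.span_zero[of D] by metis
  next
    case (step c b v)
    have "d x (s c b + v) = fun_scale s c (d x b) + d x v"
      by (auto simp: d_def fun_scale_def)
    moreover have "d x b \<in> D" using step that by (auto simp: D_def)
    ultimately show ?case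
      using step F.span_add[OF F.span_scale[OF F.span_base]] by metis
  qed
  have "f \<in> F.span D" if "f \<in> ?U" for f
  proof -
    have "f = (\<Sum>x\<in>carrier G. d x (f x))"
    proof
      fix y
      have "(\<Sum>x\<in>A. d x (f x)) y = (\<Sum>x\<in>A. d x (f x) y)" for A
        by (induction A rule: infinite_finite_induct) auto
      then show "f y = (\<Sum>x\<in>carrier G. d x (f x)) y"
        using that fin by (auto simp: d_def induced_space_def)
    qed
    also have "\<dots> \<in> F.span D"
      using that by (intro F.span_sum dspan) (auto simp: induced_space_def)
    finally show ?thesis .
  qed
  then have US: "?U \<subseteq> F.span D" by blast
  obtain C where C: "C \<subseteq> ?U" "F.independent C" "?U \<subseteq> F.span C"
    using F.maximal_independent_subset by blast
  then have "finite C" using F.independent_span_bound[OF finD] US by blast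
  moreover have "?U = F.span C"
    using C sub F.span_minimal by blast
  ultimately have fd: "\<exists>B. finite B \<and> ?U = F.span B" by blast

  have mem: "?t g f \<in> ?U" if g: "g \<in> carrier G" and f: "f \<in> ?U" for g f
    using f g by (auto simp: induced_rep_def induced_space_def G.m_assoc[symmetric])
  have one: "?t \<one>\<^bsub>G\<^esub> f = f" if "f \<in> ?U" for f
    using that by (auto simp: induced_rep_def induced_space_def)
  have mult: "?t (g \<otimes>\<^bsub>G\<^esub> k) f = ?t g (?t k f)"
    if "g \<in> carrier G" "k \<in> carrier G" "f \<in> ?U" for g k f
    using that mem[OF that(2,3)]
    by (auto simp: induced_rep_def fun_eq_iff G.inv_mult_group G.m_assoc)
  have bij: "?t g \<in> Bij ?U" if g: "g \<in> carrier G" for g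
  proof -
    have "bij_betw (?t g) ?U ?U"
      using g mem one mult[of g "inv\<^bsub>G\<^esub> g"] mult[of "inv\<^bsub>G\<^esub> g" g]
      by (intro bij_betwI[where g = "?t (inv\<^bsub>G\<^esub> g)"]) auto
    then show ?thesis by (auto simp: Bij_def induced_rep_def)
  qed
  have "linear_on (fun_scale s) ?U (?t g)" if "g \<in> carrier G" for g
    using F.subspace_add[OF sub] F.subspace_scale[OF sub]
    by (auto simp: linear_on_def induced_rep_def fun_scale_def fun_eq_iff)
  then have "?t \<in> hom G (GL (fun_scale s) ?U)"
    using bij mult
    by (auto simp: hom_def GL_def BijGroup_def compose_def induced_rep_def fun_eq_iff)
  with fd show ?thesis
    by unfold_locales
qed

end

theory Submission
  imports Defs "HOL-Algebra.Multiplicative_Group" "HOL-Computational_Algebra.Primes"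
begin

text \<open>
  Write \<open>[g, h]\<close> for a commutator and \<open>[G, h]\<close> for the set of all \<open>[g, h]\<close> with \<open>g\<close> in \<open>G\<close>. An element \<open>h\<close>
  of \<open>H\<close> lies in the center of a representation of \<open>G\<close> if and only if the kernel contains \<open>[G, h]\<close>. So a
  constituent is center-preserving on \<open>H\<close> if its kernel contains \<open>[G, h]\<close> for no \<open>h\<close> in \<open>H\<close> that is
  noncentral in \<open>G\<close>. By Frobenius reciprocity, the kernel of a constituent of the induced
  representation meets \<open>H\<close> trivially (\<open>restriction_faithful\<close>).

  Among the normal subgroups of \<open>G\<close> that meet \<open>H\<close> trivially and contain \<open>[G, h]\<close> for no noncentral \<open>h\<close> in \<open>H\<close>,
  let \<open>L\<close> be a maximal one. Let \<open>M\<close> be the set of minimal elements among the normal subgroups that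
  properly contain \<open>L\<close> and meet \<open>H\<close> trivially. Then it suffices to find a constituent whose kernel contains
  \<open>L\<close> but no member of \<open>M\<close>: if the kernel contained \<open>[G, h]\<close> for a noncentral \<open>h\<close> in \<open>H\<close>, it would be strictly
  larger than \<open>L\<close>, hence contain a member of \<open>M\<close>.

  If there is no such constituent, then by complete reducibility the space of vectors fixed by \<open>L\<close> is the sum of
  the spaces fixed by the members \<open>D\<close> of \<open>M\<close>. For any choice of elements \<open>n D\<close> of \<open>D\<close>, the product of all
  \<open>1 - n D\<close> in the group algebra then kills every vector fixed by \<open>L\<close> (\<open>exists_constituent_avoiding\<close>).
  Consider the sum \<open>f\<close> of the \<open>L\<close>-translates of a nonzero vector \<open>v\<close> of \<open>V\<close>,
  where \<open>V\<close> is embedded in the induced space as the functions supported on \<open>H\<close>. It is supported on \<open>L H\<close> with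
  value \<open>v\<close> at \<open>1\<close>. If no nonempty product of distinct elements \<open>n D\<close> lies in \<open>L H\<close>, then applying the
  product of all \<open>1 - n D\<close> to \<open>f\<close> does not change the value at \<open>1\<close>, a contradiction.

  The group-theoretic core is that the \<open>n D\<close> can be chosen in this way (\<open>separating_elements\<close>). By maximality of
  \<open>L\<close>, each \<open>D\<close> contains \<open>[G, h]\<close> for some noncentral \<open>h\<close> in \<open>H\<close>, and this \<open>h\<close> is central in \<open>H\<close>. If possible,
  \<open>n D\<close> is chosen not to commute with \<open>h\<close> modulo \<open>L\<close>; such an element cannot occur in a product in \<open>L H\<close>.
  Otherwise it is a commutator \<open>[g, h]\<close> of prime order modulo \<open>L\<close>. Different \<open>D\<close> then lead to
  different primes, because the existence of a faithful irreducible representation forces the center of \<open>H\<close> to be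
  cyclic (\<open>central_root_of_unity_is_power\<close>), and so a product of these elements has a power
  that isolates one of them.
\<close>

section \<open>Commutators and elements central modulo a normal subgroup\<close>

definition commutator :: "('a, 'b) monoid_scheme \<Rightarrow> 'a \<Rightarrow> 'a \<Rightarrow> 'a" where
  "commutator G x y = x \<otimes>\<^bsub>G\<^esub> y \<otimes>\<^bsub>G\<^esub> inv\<^bsub>G\<^esub> x \<otimes>\<^bsub>G\<^esub> inv\<^bsub>G\<^esub> y"

lemma (in group) commutator_closed [simp]:
  "x \<in> carrier G \<Longrightarrow> y \<in> carrier G \<Longrightarrow> commutator G x y \<in> carrier G"
  by (simp add: commutator_def)

lemma (in group) commutator_mult:
  "x \<in> carrier G \<Longrightarrow> y \<in> carrier G \<Longrightarrow> commutator G x y \<otimes> y \<otimes> x = x \<otimes> y"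
  by (simp add: commutator_def m_assoc)

lemma (in group) commutator_eq_one_iff:
  assumes "x \<in> carrier G" "y \<in> carrier G"
  shows "commutator G x y = \<one> \<longleftrightarrow> x \<otimes> y = y \<otimes> x"
proof -
  have "commutator G x y = \<one> \<longleftrightarrow> commutator G x y \<otimes> (y \<otimes> x) = y \<otimes> x"
    using assms by simp
  then show ?thesis using commutator_mult[OF assms] assms by (simp only: m_assoc commutator_closed)
qed

lemma (in group) inv_commutator:
  assumes "x \<in> carrier G" "y \<in> carrier G"
  shows "inv (commutator G x y) = commutator G y x"
  using assms by (simp add: commutator_def inv_mult_group m_assoc)

lemma (in group_hom) hom_commutator:
  assumes "x \<in> carrier G" "y \<in> carrier G"
  shows "h (commutator G x y) = commutator H (h x) (h y)"
  using assms by (simp add: commutator_def)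

lemma (in normal) commutator_mem_left:
  assumes "x \<in> H" "y \<in> carrier G"
  shows "commutator G x y \<in> H"
proof -
  have "x \<otimes> (y \<otimes> inv x \<otimes> inv y) \<in> H"
    by (intro subgroup.m_closed[OF subgroup_axioms] assms inv_op_closed2 subgroup.m_inv_closed[OF subgroup_axioms])
  moreover have "x \<in> carrier G" using assms(1) by (rule mem_carrier)
  ultimately show ?thesis using assms(2) by (simp add: commutator_def m_assoc)
qed

lemma (in normal) commutator_mem_right:
  assumes "x \<in> carrier G" "y \<in> H"
  shows "commutator G x y \<in> H"
proof -
  have "inv (commutator G y x) \<in> H"
    using commutator_mem_left[OF assms(2,1)] by (rule subgroup.m_inv_closed[OF subgroup_axioms])
  then show ?thesis using assms by (simp only: inv_commutator mem_carrier)
qed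

lemma (in normal) group_hom_Mod: "group_hom G (G Mod H) (\<lambda>x. H #> x)"
  using factorgroup_is_group r_coset_hom_Mod by (simp add: group_hom_def group_hom_axioms_def is_group)

lemma (in normal) coset_eq_one_iff:
  "x \<in> carrier G \<Longrightarrow> H #> x = \<one>\<^bsub>G Mod H\<^esub> \<longleftrightarrow> x \<in> H"
  using coset_join1[of H x] coset_join2[of x H] subgroup_axioms by (simp only: one_FactGroup) blast

lemma (in normal) commutator_mem_iff:
  assumes "x \<in> carrier G" "y \<in> carrier G"
  shows "commutator G x y \<in> H \<longleftrightarrow>
    (H #> x) \<otimes>\<^bsub>G Mod H\<^esub> (H #> y) = (H #> y) \<otimes>\<^bsub>G Mod H\<^esub> (H #> x)"
proof -
  interpret Q: group_hom G "G Mod H" "\<lambda>x. H #> x" by (rule group_hom_Mod)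
  have "commutator G x y \<in> H \<longleftrightarrow> commutator (G Mod H) (H #> x) (H #> y) = \<one>\<^bsub>G Mod H\<^esub>"
    using coset_eq_one_iff[OF commutator_closed[OF assms]] Q.hom_commutator[OF assms] by (simp only:)
  also have "\<dots> \<longleftrightarrow> (H #> x) \<otimes>\<^bsub>G Mod H\<^esub> (H #> y) = (H #> y) \<otimes>\<^bsub>G Mod H\<^esub> (H #> x)"
    by (rule Q.H.commutator_eq_one_iff) (use assms Q.hom_closed in blast)+
  finally show ?thesis .
qed

lemma (in group) subgroup_nat_pow_closed:
  "subgroup K G \<Longrightarrow> x \<in> K \<Longrightarrow> x [^] (n::nat) \<in> K"
  by (induction n) (auto simp: subgroup.m_closed subgroup.one_closed)

lemma (in group) mem_subgroup_if_coprime_pows_mem: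
  fixes p q :: nat
  assumes K: "subgroup K G" and x: "x \<in> carrier G" and "x [^] p \<in> K" "x [^] q \<in> K" "coprime p q"
  shows "x \<in> K"
proof (cases "p = 0")
  case True
  then show ?thesis using assms by simp
next
  case False
  then obtain a b where "p * a = q * b + gcd p q" using bezout_nat by blast
  then have "(x [^] p) [^] a = (x [^] q) [^] b \<otimes> x"
    using x assms(5) by (simp add: nat_pow_pow)
  moreover have "(x [^] q) [^] b \<in> K" "(x [^] p) [^] a \<in> K"
    using subgroup_nat_pow_closed[OF K] assms(3,4) by blast+
  ultimately show ?thesis
    using x subgroup.mem_carrier[OF K]
    by (metis K inv_solve_left subgroup.m_closed subgroup.m_inv_closed)
qed

text \<open>
  An element of least order outside \<open>Z\<close> will do: for each prime \<open>p\<close> dividing its order, its \<open>p\<close>-th power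
  has smaller order and hence lies in \<open>Z\<close>, and two such primes would put the element itself in \<open>Z\<close>.
\<close>

lemma (in group) exists_prime_power_order_notin:
  assumes fin: "finite (carrier G)" and Z: "subgroup Z G"
    and A: "A \<subseteq> carrier G" "\<And>y n. y \<in> A \<Longrightarrow> y [^] (n::nat) \<in> A" and x: "x \<in> A" "x \<notin> Z"
  obtains y p k where "y \<in> A" "y \<notin> Z" "prime (p::nat)" "ord y = p ^ k" "y [^] p \<in> Z"
proof -
  have "\<exists>y. (y \<in> A \<and> y \<notin> Z) \<and> (\<forall>z. z \<in> A \<and> z \<notin> Z \<longrightarrow> ord y \<le> ord z)"
    using x by (intro ex_has_least_nat) auto
  then obtain y where y: "y \<in> A" "y \<notin> Z" and min: "\<And>z. z \<in> A \<Longrightarrow> z \<notin> Z \<Longrightarrow> ord y \<le> ord z"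
    by (elim exE conjE) simp
  have yG: "y \<in> carrier G" using y A(1) by blast
  have ord0: "ord y \<noteq> 0" using ord_ge_1[OF fin yG] by simp
  have pow: "y [^] p \<in> Z" if "prime p" "p dvd ord y" for p :: nat
  proof (rule ccontr)
    assume "y [^] p \<notin> Z"
    then have "ord y \<le> ord (y [^] p)" using min A(2) y by simp
    also have "\<dots> = ord y div p" using that yG by (intro ord_pow) (auto dest: prime_gt_0_nat)
    also have "\<dots> < ord y" using that ord0 by (auto dest: prime_gt_1_nat)
    finally show False by simp
  qed
  have "ord y \<noteq> 1" using ord_eq_1[OF yG] y subgroup.one_closed[OF Z] by auto
  then obtain p where p: "prime p" "p dvd ord y" using prime_factor_nat by blast
  have "\<exists>k. ord y = p ^ k"
  proof (rule ccontr)
    assume "\<nexists>k. ord y = p ^ k"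
    then obtain q where "q \<in> prime_factors (ord y)" "q \<noteq> p"
      using Ex_other_prime_factor[of "ord y" p] ord0 p by auto
    then have q: "prime q" "q dvd ord y" "coprime p q"
      using p primes_coprime[of p q] by (auto simp: prime_factors_dvd)
    have "y \<in> Z"
      by (rule mem_subgroup_if_coprime_pows_mem[OF Z yG pow[OF p] pow[OF q(1,2)] q(3)])
    then show False using y by blast
  qed
  then show ?thesis using that y p pow by blast
qed


section \<open>Products outside a subgroup\<close>

definition list_mult :: "('a, 'b) monoid_scheme \<Rightarrow> 'a list \<Rightarrow> 'a" where
  "list_mult G xs = foldr (\<otimes>\<^bsub>G\<^esub>) xs \<one>\<^bsub>G\<^esub>"

lemma list_mult_simps [simp]:
  "list_mult G [] = \<one>\<^bsub>G\<^esub>" "list_mult G (x # xs) = x \<otimes>\<^bsub>G\<^esub> list_mult G xs"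
  by (simp_all add: list_mult_def)

lemma (in group) list_mult_closed [simp]:
  "set xs \<subseteq> carrier G \<Longrightarrow> list_mult G xs \<in> carrier G"
  by (induction xs) auto

lemma (in group) list_mult_append:
  "set xs \<subseteq> carrier G \<Longrightarrow> set ys \<subseteq> carrier G \<Longrightarrow>
    list_mult G (xs @ ys) = list_mult G xs \<otimes> list_mult G ys"
  by (induction xs) (auto simp: m_assoc)

lemma (in group) list_mult_commute:
  assumes "set xs \<subseteq> carrier G" "y \<in> carrier G" "\<And>x. x \<in> set xs \<Longrightarrow> x \<otimes> y = y \<otimes> x"
  shows "list_mult G xs \<otimes> y = y \<otimes> list_mult G xs"
  using assms
proof (induction xs)
  case (Cons a xs)
  then have IH: "list_mult G xs \<otimes> y = y \<otimes> list_mult G xs" and ay: "a \<otimes> y = y \<otimes> a" by auto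
  have "a \<otimes> list_mult G xs \<otimes> y = a \<otimes> (y \<otimes> list_mult G xs)"
    using Cons.prems IH by (simp add: m_assoc)
  also have "\<dots> = y \<otimes> (a \<otimes> list_mult G xs)"
    using Cons.prems ay by (simp flip: m_assoc)
  finally show ?case by simp
qed simp

lemma (in group) list_mult_nat_pow:
  assumes "set xs \<subseteq> carrier G" "\<And>x y. x \<in> set xs \<Longrightarrow> y \<in> set xs \<Longrightarrow> x \<otimes> y = y \<otimes> x"
  shows "list_mult G xs [^] (n::nat) = list_mult G (map (\<lambda>x. x [^] n) xs)"
  using assms
proof (induction xs)
  case (Cons a xs)
  then have "list_mult G xs \<otimes> a = a \<otimes> list_mult G xs"
    by (intro list_mult_commute) auto
  then show ?case using Cons by (simp add: pow_mult_distrib)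
qed simp

lemma (in group_hom) hom_list_mult:
  "set xs \<subseteq> carrier G \<Longrightarrow> h (list_mult G xs) = list_mult H (map h xs)"
  by (induction xs) auto

lemma (in group) list_mult_eq_one: "set xs \<subseteq> {\<one>} \<Longrightarrow> list_mult G xs = \<one>"
  by (induction xs) auto

text \<open>
  Each \<open>h i\<close> centralizes \<open>K\<close> and all \<open>n j\<close> with \<open>j \<noteq> i\<close>. If the product lay in \<open>K\<close>, it would
  commute with every \<open>h i\<close>, and then so would \<open>n i\<close>. In
  that case the \<open>n i\<close> have distinct prime orders. Raising the product to the product of all primes but one leaves
  a power of a single \<open>n i\<close> that lies in \<open>K\<close>, so it is \<open>\<one>\<close>, which is impossible as the exponent is prime to
  the order of \<open>n i\<close>.
\<close>

lemma (in group) list_mult_notin_subgroup: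
  assumes K: "subgroup K G" and dist: "distinct is" and ne: "is \<noteq> []"
    and n: "\<And>i. i \<in> set is \<Longrightarrow> n i \<in> carrier G"
    and h: "\<And>i x. i \<in> set is \<Longrightarrow> x \<in> K \<Longrightarrow> h i \<in> K \<and> h i \<otimes> x = x \<otimes> h i"
    and comm: "\<And>i j. i \<in> set is \<Longrightarrow> j \<in> set is \<Longrightarrow> i \<noteq> j \<Longrightarrow>
      n i \<otimes> n j = n j \<otimes> n i \<and> n i \<otimes> h j = h j \<otimes> n i"
    and p: "\<And>i. i \<in> set is \<Longrightarrow> n i \<otimes> h i = h i \<otimes> n i \<Longrightarrow>
      prime (p i :: nat) \<and> n i [^] p i = \<one> \<and> n i \<noteq> \<one> \<and> (\<forall>m::nat. n i [^] m \<in> K \<longrightarrow> n i [^] m = \<one>)"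
    and p_inj: "\<And>i j. i \<in> set is \<Longrightarrow> j \<in> set is \<Longrightarrow> n i \<otimes> h i = h i \<otimes> n i \<Longrightarrow>
      n j \<otimes> h j = h j \<otimes> n j \<Longrightarrow> p i = p j \<Longrightarrow> i = j"
  shows "list_mult G (map n is) \<notin> K"
proof
  assume mem: "list_mult G (map n is) \<in> K"
  have hK: "h i \<in> K" if "i \<in> set is" for i using h[OF that subgroup.one_closed[OF K]] by simp
  then have hG: "h i \<in> carrier G" if "i \<in> set is" for i
    using that K subgroup.mem_carrier by metis
  have nG: "set (map n js) \<subseteq> carrier G" if "set js \<subseteq> set is" for js using n that by auto
  \<comment> \<open>cancel the factors on either side of \<open>n i\<close>, which commute with \<open>h i\<close>\<close>
  have commh: "n i \<otimes> h i = h i \<otimes> n i" if i: "i \<in> set is" for i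
  proof -
    obtain xs ys where xy: "is = xs @ i # ys" using split_list[OF i] by blast
    define X Y where "X = list_mult G (map n xs)" and "Y = list_mult G (map n ys)"
    have XY: "X \<in> carrier G" "Y \<in> carrier G" using n by (auto simp: X_def Y_def xy intro!: list_mult_closed)
    have "X \<otimes> h i = h i \<otimes> X"
      using n dist comm[of _ i] hG[OF i] unfolding X_def by (intro list_mult_commute) (auto simp: xy)
    moreover have "Y \<otimes> h i = h i \<otimes> Y"
      using n dist comm[of _ i] hG[OF i] unfolding Y_def by (intro list_mult_commute) (auto simp: xy)
    moreover have t: "list_mult G (map n is) = X \<otimes> (n i \<otimes> Y)"
      using n unfolding X_def Y_def xy by (simp add: list_mult_append image_subset_iff)
    moreover have "h i \<otimes> list_mult G (map n is) = list_mult G (map n is) \<otimes> h i" using h[OF i mem] by simp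
    ultimately have hX: "X \<otimes> h i = h i \<otimes> X" and hY: "Y \<otimes> h i = h i \<otimes> Y"
      and ht: "h i \<otimes> (X \<otimes> (n i \<otimes> Y)) = X \<otimes> (n i \<otimes> Y) \<otimes> h i" by simp_all
    have "X \<otimes> (h i \<otimes> (n i \<otimes> Y)) = h i \<otimes> (X \<otimes> (n i \<otimes> Y))"
      using XY hG[OF i] n[OF i] hX by (simp flip: m_assoc)
    also have "\<dots> = X \<otimes> (n i \<otimes> (h i \<otimes> Y))"
      using XY hG[OF i] n[OF i] hY ht by (simp add: m_assoc)
    finally have "X \<otimes> (h i \<otimes> (n i \<otimes> Y)) = X \<otimes> (n i \<otimes> (h i \<otimes> Y))" .
    then have "h i \<otimes> n i \<otimes> Y = n i \<otimes> h i \<otimes> Y"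
      using XY hG[OF i] n[OF i] by (simp add: m_assoc)
    then show ?thesis using XY hG[OF i] n[OF i] by simp
  qed
  obtain i js where ij: "is = i # js" using ne by (cases "is") auto
  define m where "m = (\<Prod>j\<in>set js. p j)"
  have "n j [^] m = \<one>" if "j \<in> set js" for j
  proof -
    have "p j dvd m" unfolding m_def using that by (intro dvd_prodI) auto
    then obtain c where "m = p j * c" by blast
    then show ?thesis using p[OF _ commh, of j] n[of j] that by (simp add: ij flip: nat_pow_pow)
  qed
  moreover have njs_comm: "x \<otimes> y = y \<otimes> x" if "x \<in> set (map n js)" "y \<in> set (map n js)" for x y
    using that comm by (auto simp: ij)
  ultimately have "list_mult G (map n js) [^] m = \<one>"
    using list_mult_nat_pow[of "map n js" m] list_mult_eq_one[of "map (\<lambda>x. x [^] m) (map n js)"]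
      njs_comm nG[of js] by (auto simp: ij image_subset_iff)
  moreover have "n i \<otimes> list_mult G (map n js) = list_mult G (map n js) \<otimes> n i"
    using n comm[of _ i] dist by (intro list_mult_commute[symmetric]) (auto simp: ij)
  ultimately have "list_mult G (map n is) [^] m = n i [^] m"
    using n by (simp add: ij pow_mult_distrib image_subset_iff)
  then have "n i [^] m \<in> K" using subgroup_nat_pow_closed[OF K mem, of m] by simp
  then have "n i [^] m = \<one>" and pi: "prime (p i)" "n i [^] p i = \<one>" "n i \<noteq> \<one>"
    using p[OF _ commh, of i] by (auto simp: ij)
  moreover have "coprime (p i) m" unfolding m_def
  proof (rule prod_coprime_right)
    fix j assume j: "j \<in> set js"
    then have "p i \<noteq> p j" using p_inj[OF _ _ commh commh, of i j] dist by (auto simp: ij)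
    then show "coprime (p i) (p j)" using p[OF _ commh, of j] pi j by (auto simp: ij primes_coprime)
  qed
  ultimately show False
    using mem_subgroup_if_coprime_pows_mem[OF triv_subgroup, of "n i" "p i" m] n[of i] by (auto simp: ij)
qed


text \<open>
  Since \<open>x y x\<^sup>-\<^sup>1 = [x, y] y\<close> with commuting factors, the \<open>m\<close>-th power of this conjugate can be
  computed factor by factor.
\<close>

lemma (in group) commutator_nat_pow_right:
  fixes m :: nat
  assumes x: "x \<in> carrier G" and y: "y \<in> carrier G"
    and c: "commutator G x y \<otimes> y = y \<otimes> commutator G x y"
  shows "commutator G x (y [^] m) = commutator G x y [^] m"
proof -
  have conj: "(x \<otimes> y \<otimes> inv x) [^] m = x \<otimes> y [^] m \<otimes> inv x"
  proof (induction m)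
    case (Suc m)
    have "inv x \<otimes> (x \<otimes> (y \<otimes> inv x)) = y \<otimes> inv x"
      using x y by (simp flip: m_assoc)
    then show ?case using Suc x y by (simp add: m_assoc)
  qed (use x in simp)
  have "commutator G x y [^] m \<otimes> y [^] m = (commutator G x y \<otimes> y) [^] m"
    using pow_mult_distrib[OF c] x y by simp
  also have "commutator G x y \<otimes> y = x \<otimes> y \<otimes> inv x"
    using x y by (simp add: commutator_def m_assoc)
  finally have "commutator G x y [^] m \<otimes> y [^] m = x \<otimes> y [^] m \<otimes> inv x" by (simp add: conj)
  then have "commutator G x y [^] m \<otimes> y [^] m \<otimes> inv (y [^] m) = x \<otimes> y [^] m \<otimes> inv x \<otimes> inv (y [^] m)"
    by simp
  then show ?thesis using x y by (simp add: m_assoc) (simp add: commutator_def m_assoc)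
qed

lemma (in group) subgroup_group_center: "subgroup (group_center G) G"
proof (rule subgroupI)
  show "group_center G \<subseteq> carrier G" by (auto simp: group_center_def)
  have "\<one> \<in> group_center G" by (simp add: group_center_def)
  then show "group_center G \<noteq> {}" by blast
  show "inv a \<in> group_center G" if a: "a \<in> group_center G" for a
  proof -
    have aG: "a \<in> carrier G" and ax: "a \<otimes> x = x \<otimes> a" if "x \<in> carrier G" for x
      using a that unfolding group_center_def by blast+
    have "inv a \<otimes> x = x \<otimes> inv a" if x: "x \<in> carrier G" for x
    proof -
      have "inv (a \<otimes> inv x) = inv (inv x \<otimes> a)" using ax[of "inv x"] x by simp
      then show ?thesis using aG[OF x] x by (simp add: inv_mult_group)
    qed
    then show ?thesis using a unfolding group_center_def by simp
  qed
  show "a \<otimes> b \<in> group_center G" if a: "a \<in> group_center G" and b: "b \<in> group_center G" for a b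
  proof -
    have G: "a \<in> carrier G" "b \<in> carrier G" using a b unfolding group_center_def by blast+
    have "a \<otimes> b \<otimes> x = x \<otimes> (a \<otimes> b)" if x: "x \<in> carrier G" for x
    proof -
      have ax: "a \<otimes> x = x \<otimes> a" and bx: "b \<otimes> x = x \<otimes> b"
        using a b x unfolding group_center_def by blast+
      have "a \<otimes> b \<otimes> x = a \<otimes> (b \<otimes> x)" using G x by (simp add: m_assoc)
      also have "\<dots> = a \<otimes> x \<otimes> b" using G x by (simp add: bx m_assoc)
      also have "\<dots> = x \<otimes> (a \<otimes> b)" using G x by (simp only: ax m_assoc)
      finally show ?thesis .
    qed
    then show ?thesis using G unfolding group_center_def by blast
  qed
qed

lemma (in group) mem_group_center_iff:
  "h \<in> carrier G \<Longrightarrow> h \<in> group_center G \<longleftrightarrow> (\<forall>g\<in>carrier G. commutator G g h = \<one>)"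
  using commutator_eq_one_iff[of _ h] unfolding group_center_def by fastforce

lemma (in normal) central_mod_nat_pow:
  fixes m :: nat
  assumes h: "h \<in> carrier G" and c: "\<forall>g\<in>carrier G. commutator G g h \<in> H"
  shows "\<forall>g\<in>carrier G. commutator G g (h [^] m) \<in> H"
proof
  fix g assume g: "g \<in> carrier G"
  interpret Q: group_hom G "G Mod H" "\<lambda>x. H #> x" by (rule group_hom_Mod)
  have "(H #> h) \<otimes>\<^bsub>G Mod H\<^esub> (H #> g) = (H #> g) \<otimes>\<^bsub>G Mod H\<^esub> (H #> h)"
    using c g commutator_mem_iff[OF g h] by simp
  then have "(H #> h) [^]\<^bsub>G Mod H\<^esub> m \<otimes>\<^bsub>G Mod H\<^esub> (H #> g) = (H #> g) \<otimes>\<^bsub>G Mod H\<^esub> (H #> h) [^]\<^bsub>G Mod H\<^esub> m"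
    using Q.hom_closed[OF h] Q.hom_closed[OF g] by (rule Q.H.group_commutes_pow)
  then show "commutator G g (h [^] m) \<in> H"
    using commutator_mem_iff[OF g, of "h [^] m"] h Q.hom_nat_pow[OF h, of m] by simp
qed

lemma (in group) normal_Int:
  assumes "D \<lhd> G" "E \<lhd> G"
  shows "D \<inter> E \<lhd> G"
  using assms subgroups_Inter_pair[of D E] by (auto simp: normal_inv_iff)


text \<open>
  By \<open>L_max\<close> each \<open>D\<close> in \<open>M\<close> contains all commutators \<open>[g, h]\<close> for some \<open>h\<close> in \<open>H\<close> that is not central
  in \<open>G\<close>, and \<open>h\<close> may be taken of \<open>p\<close>-power order with \<open>h\<^sup>p\<close> central in \<open>G\<close>. As \<open>[H, h] \<subseteq> D \<inter> H = 1\<close>,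
  it is central in \<open>H\<close>. Distinct members of \<open>M\<close> meet in \<open>L\<close>, so that modulo \<open>L\<close> they centralize each other,
  and the \<open>h\<close> of one of them centralizes the others.

  If some \<open>n\<close> in \<open>D\<close> does not commute with \<open>h\<close> modulo \<open>L\<close>, it is chosen. If there is none, choose
  \<open>n = [g, h]\<close> outside \<open>L\<close>; then \<open>n\<^sup>p \<equiv> [g, h\<^sup>p] = 1\<close> modulo \<open>L\<close>. The primes \<open>p\<close> that occur here
  are distinct: of two central elements of \<open>H\<close> of \<open>p\<close>-power order one is a power of the other by \<open>roots\<close>,
  so if \<open>D\<close> and \<open>E\<close> shared \<open>p\<close>, one of the two elements \<open>h\<close> would have all its commutators in
  \<open>D \<inter> E = L\<close>, against \<open>L_small\<close>.
\<close>

lemma (in group) separating_elements: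
  assumes fin: "finite (carrier G)" and H: "subgroup H G"
    and roots: "\<And>x y. x \<in> group_center (G\<lparr>carrier := H\<rparr>) \<Longrightarrow> y \<in> group_center (G\<lparr>carrier := H\<rparr>) \<Longrightarrow>
      y [^] ord x = \<one> \<Longrightarrow> \<exists>m::nat. y = x [^] m"
    and L: "L \<lhd> G"
    and L_small: "\<And>h. h \<in> H \<Longrightarrow> h \<notin> group_center G \<Longrightarrow> \<exists>g\<in>carrier G. commutator G g h \<notin> L"
    and L_max: "\<And>D. D \<lhd> G \<Longrightarrow> L \<subset> D \<Longrightarrow> D \<inter> H = {\<one>} \<Longrightarrow>
      \<exists>h\<in>H. h \<notin> group_center G \<and> (\<forall>g\<in>carrier G. commutator G g h \<in> D)"
    and M: "\<And>D. D \<in> M \<Longrightarrow> D \<lhd> G \<and> L \<subset> D \<and> D \<inter> H = {\<one>} \<and> (\<forall>E. E \<lhd> G \<longrightarrow> L \<subset> E \<longrightarrow> E \<subseteq> D \<longrightarrow> E = D)"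
  shows "\<exists>n. (\<forall>D\<in>M. n D \<in> D) \<and>
    (\<forall>Ds. distinct Ds \<longrightarrow> Ds \<noteq> [] \<longrightarrow> set Ds \<subseteq> M \<longrightarrow> list_mult G (map n Ds) \<notin> L <#> H)"
proof -
  interpret L: normal L G by fact
  interpret Q: group_hom G "G Mod L" "\<lambda>x. L #> x" by (rule L.group_hom_Mod)
  have HG: "x \<in> carrier G" if "x \<in> H" for x using H that by (rule subgroup.mem_carrier)
  have normD: "D \<lhd> G" and LD: "L \<subset> D" and DH: "D \<inter> H = {\<one>}"
    and minD: "E \<lhd> G \<Longrightarrow> L \<subset> E \<Longrightarrow> E \<subseteq> D \<Longrightarrow> E = D" if "D \<in> M" for D E
    using M[OF that] by blast+
  define P where "P D h p n \<longleftrightarrow> h \<in> H \<and> h \<notin> group_center G \<and> (\<forall>g\<in>carrier G. commutator G g h \<in> D) \<and>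
      prime p \<and> (\<exists>k. ord h = p ^ k) \<and> h [^] p \<in> group_center G \<and> n \<in> D \<and>
      (commutator G n h \<in> L \<longrightarrow> (\<exists>g\<in>carrier G. n = commutator G g h \<and> n \<notin> L))" for D h and p :: nat and n
  have "\<exists>h p n. P D h p n" if D: "D \<in> M" for D
  proof -
    interpret D: normal D G by (rule normD[OF D])
    define A where "A = {h \<in> H. \<forall>g\<in>carrier G. commutator G g h \<in> D}"
    have A: "A \<subseteq> carrier G" using HG by (auto simp: A_def)
    have Apow: "y [^] (m::nat) \<in> A" if "y \<in> A" for y m
      using that D.central_mod_nat_pow[of y m] subgroup_nat_pow_closed[OF H, of y m] HG[of y]
      by (auto simp: A_def)
    obtain h0 where h0: "h0 \<in> A" "h0 \<notin> group_center G"
      using L_max[OF normD[OF D] LD[OF D] DH[OF D]] unfolding A_def by blast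
    obtain h p k where h: "h \<in> A" "h \<notin> group_center G" "prime (p::nat)" "ord h = p ^ k"
        "h [^] p \<in> group_center G"
      by (rule exists_prime_power_order_notin[OF fin subgroup_group_center A Apow h0])
    show ?thesis
    proof (cases "\<exists>n\<in>D. commutator G n h \<notin> L")
      case True
      then obtain n where "n \<in> D" "commutator G n h \<notin> L" by blast
      then have "P D h p n" using h unfolding P_def A_def by blast
      then show ?thesis by blast
    next
      case False
      obtain g where "g \<in> carrier G" "commutator G g h \<notin> L"
        using L_small[of h] h unfolding A_def by blast
      then have "P D h p (commutator G g h)" using h unfolding P_def A_def by blast
      then show ?thesis by blast
    qed
  qed
  then have "\<forall>D\<in>M. \<exists>t. P D (fst t) (fst (snd t)) (snd (snd t))" by simp
  from bchoice[OF this] obtain t where "\<forall>D\<in>M. P D (fst (t D)) (fst (snd (t D))) (snd (snd (t D)))" ..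
  then have t: "P D (fst (t D)) (fst (snd (t D))) (snd (snd (t D)))" if "D \<in> M" for D using that ..
  define h p n where "h D = fst (t D)" and "p D = fst (snd (t D))" and "n D = snd (snd (t D))" for D
  have hpn: "P D (h D) (p D) (n D)" if "D \<in> M" for D using t[OF that] by (simp only: h_def p_def n_def)
  have hH: "h D \<in> H" and hZ: "h D \<notin> group_center G" and hD: "\<And>g. g \<in> carrier G \<Longrightarrow> commutator G g (h D) \<in> D"
    and pD: "prime (p D)" and ordh: "\<exists>k. ord (h D) = p D ^ k" and hp: "h D [^] p D \<in> group_center G"
    and nD: "n D \<in> D"
    and nL: "commutator G (n D) (h D) \<in> L \<Longrightarrow> \<exists>g\<in>carrier G. n D = commutator G g (h D) \<and> n D \<notin> L"
    if "D \<in> M" for D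
    using hpn[OF that] unfolding P_def by blast+
  have nG: "n D \<in> carrier G" if "D \<in> M" for D
    using subgroup.mem_carrier[OF normal.axioms(1)[OF normD[OF that]] nD[OF that]] .
  have Int: "D \<inter> E = L" if "D \<in> M" "E \<in> M" "D \<noteq> E" for D E
  proof (rule ccontr)
    assume "D \<inter> E \<noteq> L"
    then have "L \<subset> D \<inter> E" using LD[OF that(1)] LD[OF that(2)] by blast
    then have "D \<inter> E = D" "D \<inter> E = E"
      using minD[OF that(1) normal_Int[OF normD normD]] minD[OF that(2) normal_Int[OF normD normD]] that by auto
    then show False using that(3) by simp
  qed
  have h_comm: "h D \<otimes> x = x \<otimes> h D" if "D \<in> M" "x \<in> H" for D x
  proof -
    have "commutator G x (h D) \<in> H"
      using hH[OF that(1)] that(2) H by (simp add: commutator_def subgroup.m_closed subgroup.m_inv_closed)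
    then have "commutator G x (h D) = \<one>"
      using hD[OF that(1) HG[OF that(2)]] DH[OF that(1)] by blast
    then show ?thesis using commutator_eq_one_iff[of x "h D"] HG hH that by simp
  qed
  then have h_center: "h D \<in> group_center (G\<lparr>carrier := H\<rparr>)" if "D \<in> M" for D
    using that hH by (simp add: group_center_def)
  have n_pow: "n D [^] p D \<in> L" if D: "D \<in> M" and a: "commutator G (n D) (h D) \<in> L" for D
  proof -
    obtain g where g: "g \<in> carrier G" "n D = commutator G g (h D)" using nL[OF D a] by blast
    have hG: "h D \<in> carrier G" using HG hH D by blast
    have hp_closed: "h D [^] p D \<in> carrier G" and np_closed: "n D [^] p D \<in> carrier G"
      using hG nG[OF D] by simp_all
    have c: "commutator (G Mod L) (L #> g) (L #> h D) = L #> n D"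
      by (simp only: g(2) Q.hom_commutator[OF g(1) hG])
    have comm: "(L #> n D) \<otimes>\<^bsub>G Mod L\<^esub> (L #> h D) = (L #> h D) \<otimes>\<^bsub>G Mod L\<^esub> (L #> n D)"
      using a L.commutator_mem_iff[OF nG[OF D] hG] by blast
    have "L #> (n D [^] p D) = (L #> n D) [^]\<^bsub>G Mod L\<^esub> p D"
      by (rule Q.hom_nat_pow[OF nG[OF D]])
    also have "\<dots> = commutator (G Mod L) (L #> g) ((L #> h D) [^]\<^bsub>G Mod L\<^esub> p D)"
      using Q.H.commutator_nat_pow_right[OF Q.hom_closed[OF g(1)] Q.hom_closed[OF hG], of "p D"]
      unfolding c using comm by (simp only:)
    also have "\<dots> = L #> commutator G g (h D [^] p D)"
      by (simp only: Q.hom_commutator[OF g(1) hp_closed] Q.hom_nat_pow[OF hG])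
    also have "commutator G g (h D [^] p D) = \<one>"
      using hp[OF D] g(1) mem_group_center_iff[OF hp_closed] by blast
    finally have "L #> (n D [^] p D) = \<one>\<^bsub>G Mod L\<^esub>" by (simp only: Q.hom_one)
    then show ?thesis using L.coset_eq_one_iff[OF np_closed] by blast
  qed
  \<comment> \<open>here \<open>h D\<close> is a power of \<open>h E\<close>, so its commutators lie in \<open>D\<close> and in \<open>E\<close>\<close>
  have p_inj_le: "D = E" if D: "D \<in> M" and E: "E \<in> M" and p: "p D = p E" and le: "ord (h D) dvd ord (h E)" for D E
  proof (rule ccontr)
    assume ne: "D \<noteq> E"
    interpret E: normal E G by (rule normD[OF E])
    have hG: "h D \<in> carrier G" "h E \<in> carrier G" using HG hH D E by auto
    have "h D [^] ord (h E) = \<one>" using pow_eq_id[OF hG(1)] le by blast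
    then obtain m :: nat where "h D = h E [^] m" using roots[OF h_center[OF E] h_center[OF D]] by blast
    then have "\<forall>g\<in>carrier G. commutator G g (h D) \<in> E"
      using E.central_mod_nat_pow[OF hG(2)] hD[OF E] by simp
    then have "\<forall>g\<in>carrier G. commutator G g (h D) \<in> L" using hD[OF D] Int[OF D E ne] by blast
    then show False using L_small[OF hH hZ, OF D D] by blast
  qed
  have p_inj: "D = E" if D: "D \<in> M" and E: "E \<in> M" and p: "p D = p E" for D E
  proof -
    obtain k l where kl: "ord (h D) = p D ^ k" "ord (h E) = p D ^ l" using ordh[OF D] ordh[OF E] p by auto
    show ?thesis
      using p_inj_le[OF D E p] p_inj_le[OF E D p[symmetric]] kl
      by (cases "k \<le> l") (auto simp: le_imp_power_dvd)
  qed
  have "list_mult G (map n Ds) \<notin> L <#> H" if Ds: "distinct Ds" "Ds \<noteq> []" "set Ds \<subseteq> M" for Ds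
  proof
    assume mem: "list_mult G (map n Ds) \<in> L <#> H"
    have K: "subgroup ((\<lambda>x. L #> x) ` H) (G Mod L)" using Q.subgroup_img_is_subgroup[OF H] .
    have "L #> list_mult G (map n Ds) \<in> (\<lambda>x. L #> x) ` H"
    proof -
      obtain l x where lx: "l \<in> L" "x \<in> H" "list_mult G (map n Ds) = l \<otimes> x"
        using mem by (auto simp: set_mult_def)
      have "L #> (l \<otimes> x) = (L #> l) \<otimes>\<^bsub>G Mod L\<^esub> (L #> x)" by (rule Q.hom_mult) (use lx HG in auto)
      also have "L #> l = \<one>\<^bsub>G Mod L\<^esub>" using L.coset_eq_one_iff lx by simp
      also have "\<one>\<^bsub>G Mod L\<^esub> \<otimes>\<^bsub>G Mod L\<^esub> (L #> x) = L #> x"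
        using Q.H.l_one[OF Q.hom_closed[OF HG[OF lx(2)]]] .
      finally show ?thesis using lx by auto
    qed
    moreover have "L #> list_mult G (map n Ds) = list_mult (G Mod L) (map (\<lambda>D. L #> n D) Ds)"
      using Ds nG by (subst Q.hom_list_mult) (auto simp: o_def)
    moreover have "list_mult (G Mod L) (map (\<lambda>D. L #> n D) Ds) \<notin> (\<lambda>x. L #> x) ` H"
    proof (rule Q.H.list_mult_notin_subgroup[OF K Ds(1,2), where h = "\<lambda>D. L #> h D" and p = p])
      fix D assume "D \<in> set Ds"
      then have D: "D \<in> M" using Ds by blast
      have hG: "h D \<in> carrier G" using HG hH D by blast
      show "L #> n D \<in> carrier (G Mod L)" using Q.hom_closed[OF nG[OF D]] .
      show "L #> h D \<in> (\<lambda>x. L #> x) ` H \<and> (L #> h D) \<otimes>\<^bsub>G Mod L\<^esub> x = x \<otimes>\<^bsub>G Mod L\<^esub> (L #> h D)"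
        if x: "x \<in> (\<lambda>x. L #> x) ` H" for x
      proof -
        obtain y where y: "y \<in> H" "x = L #> y" using x by blast
        have "(L #> h D) \<otimes>\<^bsub>G Mod L\<^esub> x = L #> (h D \<otimes> y)" using Q.hom_mult[OF hG HG[OF y(1)]] y by simp
        also have "\<dots> = x \<otimes>\<^bsub>G Mod L\<^esub> (L #> h D)"
          using Q.hom_mult[OF HG[OF y(1)] hG] y h_comm[OF D y(1)] by simp
        finally show ?thesis using hH[OF D] by blast
      qed
      show "(L #> n D) \<otimes>\<^bsub>G Mod L\<^esub> (L #> n E) = (L #> n E) \<otimes>\<^bsub>G Mod L\<^esub> (L #> n D) \<and>
          (L #> n D) \<otimes>\<^bsub>G Mod L\<^esub> (L #> h E) = (L #> h E) \<otimes>\<^bsub>G Mod L\<^esub> (L #> n D)"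
        if "E \<in> set Ds" and ne: "D \<noteq> E" for E
      proof -
        have E: "E \<in> M" using that Ds by blast
        interpret D: normal D G by (rule normD[OF D])
        interpret E: normal E G by (rule normD[OF E])
        have "commutator G (n D) (n E) \<in> D \<inter> E"
          using D.commutator_mem_left[OF nD[OF D] nG[OF E]] E.commutator_mem_right[OF nG[OF D] nD[OF E]] by blast
        moreover have "commutator G (n D) (h E) \<in> D \<inter> E"
          using D.commutator_mem_left[OF nD[OF D]] hD[OF E nG[OF D]] HG[OF hH[OF E]] by blast
        ultimately show ?thesis
          using L.commutator_mem_iff[OF nG[OF D] nG[OF E]] L.commutator_mem_iff[OF nG[OF D] HG[OF hH[OF E]]]
            Int[OF D E ne] by blast
      qed
      assume "(L #> n D) \<otimes>\<^bsub>G Mod L\<^esub> (L #> h D) = (L #> h D) \<otimes>\<^bsub>G Mod L\<^esub> (L #> n D)"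
      then have a: "commutator G (n D) (h D) \<in> L" using L.commutator_mem_iff[OF nG[OF D] hG] by blast
      have 1: "(L #> n D) [^]\<^bsub>G Mod L\<^esub> p D = \<one>\<^bsub>G Mod L\<^esub>"
        using n_pow[OF D a] L.coset_eq_one_iff[of "n D [^] p D"] nG[OF D] Q.hom_nat_pow[OF nG[OF D], of "p D"] by simp
      have 2: "L #> n D \<noteq> \<one>\<^bsub>G Mod L\<^esub>"
        using nL[OF D a] L.coset_eq_one_iff[of "n D"] nG[OF D] by blast
      \<comment> \<open>a power of \<open>n D\<close> in \<open>L H\<close> lies in \<open>D \<inter> L H\<close>, which is \<open>L\<close> because \<open>D \<inter> H\<close> is trivial\<close>
      have 3: "(L #> n D) [^]\<^bsub>G Mod L\<^esub> m = \<one>\<^bsub>G Mod L\<^esub>"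
        if m: "(L #> n D) [^]\<^bsub>G Mod L\<^esub> m \<in> (\<lambda>x. L #> x) ` H" for m :: nat
      proof -
        interpret D: normal D G by (rule normD[OF D])
        obtain x where x: "x \<in> H" "L #> (n D [^] m) = L #> x"
          using m Q.hom_nat_pow[OF nG[OF D], of m] by auto
        have "x \<in> L #> (n D [^] m)" using x rcos_self[OF HG[OF x(1)] L.subgroup_axioms] by simp
        then obtain l where "l \<in> L" "x = l \<otimes> n D [^] m" by (auto simp: r_coset_def)
        moreover have "n D [^] m \<in> D" using subgroup_nat_pow_closed[OF D.subgroup_axioms nD[OF D]] .
        ultimately have "x \<in> D" using LD[OF D] subgroup.m_closed[OF D.subgroup_axioms] by blast
        then have "x = \<one>" using DH[OF D] x by blast
        then show ?thesis using x Q.hom_nat_pow[OF nG[OF D], of m] Q.hom_one by simp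
      qed
      show "prime (p D) \<and> (L #> n D) [^]\<^bsub>G Mod L\<^esub> p D = \<one>\<^bsub>G Mod L\<^esub> \<and> L #> n D \<noteq> \<one>\<^bsub>G Mod L\<^esub> \<and>
          (\<forall>m::nat. (L #> n D) [^]\<^bsub>G Mod L\<^esub> m \<in> (\<lambda>x. L #> x) ` H \<longrightarrow> (L #> n D) [^]\<^bsub>G Mod L\<^esub> m = \<one>\<^bsub>G Mod L\<^esub>)"
        using 1 2 3 pD[OF D] by blast
      show "D = E" if "E \<in> set Ds" "p D = p E" for E
        using p_inj[OF D _ that(2)] that(1) Ds(3) by blast
    qed
    ultimately show False by simp
  qed
  then show ?thesis using nD by blast
qed

section \<open>Complete reducibility\<close>

context linear_rep
begin

lemma subspace_V: "subspace V"
  using finite_dim by auto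

lemma act_Bij: "g \<in> carrier G \<Longrightarrow> \<sigma> g \<in> Bij V"
  and act_linear: "g \<in> carrier G \<Longrightarrow> linear_on s V (\<sigma> g)"
  using hom_GL by (auto simp: hom_def GL_def)

lemma act_closed [simp]: "g \<in> carrier G \<Longrightarrow> u \<in> V \<Longrightarrow> \<sigma> g u \<in> V"
  using act_Bij Bij_imp_funcset by blast

lemma act_mult: "g \<in> carrier G \<Longrightarrow> k \<in> carrier G \<Longrightarrow> u \<in> V \<Longrightarrow> \<sigma> (g \<otimes> k) u = \<sigma> g (\<sigma> k u)"
  using hom_GL act_Bij by (simp add: hom_def GL_def BijGroup_def compose_def)

lemma act_one [simp]: "u \<in> V \<Longrightarrow> \<sigma> \<one> u = u"
  using act_mult[of \<one> \<one> u] act_Bij[of \<one>] inj_onD[of "\<sigma> \<one>" V "\<sigma> \<one> u" u]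
  by (auto simp: Bij_def bij_betw_def)

lemma act_inv [simp]:
  "g \<in> carrier G \<Longrightarrow> u \<in> V \<Longrightarrow> \<sigma> (inv g) (\<sigma> g u) = u"
  "g \<in> carrier G \<Longrightarrow> u \<in> V \<Longrightarrow> \<sigma> g (\<sigma> (inv g) u) = u"
  by (simp_all flip: act_mult)

lemmas act_add = linear_onD(1)[OF act_linear]
  and act_scale = linear_onD(2)[OF act_linear]

lemma act_zero [simp]: "g \<in> carrier G \<Longrightarrow> \<sigma> g 0 = 0"
  using act_scale[of g 0 0] subspace_0[OF subspace_V] by simp

lemma act_sum:
  assumes "g \<in> carrier G" "\<And>i. i \<in> I \<Longrightarrow> f i \<in> V"
  shows "\<sigma> g (\<Sum>i\<in>I. f i) = (\<Sum>i\<in>I. \<sigma> g (f i))"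
  using assms(2)
proof (induction I rule: infinite_finite_induct)
  case (insert i I)
  then show ?case
    using act_add[OF assms(1), of "f i" "sum f I"] subspace_sum[OF subspace_V, of I f] by simp
qed (use assms(1) in simp_all)

lemma act_eq_iff:
  assumes "g \<in> carrier G" "k \<in> carrier G"
  shows "\<sigma> g = \<sigma> k \<longleftrightarrow> (\<forall>u\<in>V. \<sigma> g u = \<sigma> k u)"
  using act_Bij[OF assms(1)] act_Bij[OF assms(2)] by (auto simp: Bij_def intro: extensionalityI)

lemma invariant_subspace_whole: "invariant_subspace s G V \<sigma> V"
  using subspace_V by (simp add: invariant_subspace_def)

text \<open>
  Maschke's theorem: averaging a linear projection onto \<open>X\<close> over the group gives an equivariant
  projection, whose kernel is the complement.
\<close>

proposition invariant_complement:
  assumes fin: "finite (carrier G)" and char: "of_nat (order G) \<noteq> (0::'f)"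
    and X: "invariant_subspace s G V \<sigma> X"
  shows "\<exists>Y. invariant_subspace s G V \<sigma> Y \<and> X \<inter> Y = {0} \<and> V = {x + y | x y. x \<in> X \<and> y \<in> Y}"
proof -
  interpret pair: vector_space_pair s s by unfold_locales
  have XV: "X \<subseteq> V" and subX: "subspace X" and actX: "\<And>g x. g \<in> carrier G \<Longrightarrow> x \<in> X \<Longrightarrow> \<sigma> g x \<in> X"
    using X by (auto simp: invariant_subspace_def)
  obtain p where pX: "\<And>u. p u \<in> X" and lin: "Vector_Spaces.linear s s p" and p_id: "\<And>x. x \<in> X \<Longrightarrow> p x = x"
    using pair.linear_exists_left_inverse_on[OF linear_id subX] by (auto simp: image_subset_iff)
  interpret p: Vector_Spaces.linear s s p by fact
  define avg where "avg u = s (1 / of_nat (order G)) (\<Sum>g\<in>carrier G. \<sigma> (inv g) (p (\<sigma> g u)))" for u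
  have avgX: "avg u \<in> X" for u
    unfolding avg_def by (intro subspace_scale[OF subX] subspace_sum[OF subX] actX pX) simp
  have avg_id: "avg x = x" if "x \<in> X" for x
  proof -
    have "(\<Sum>g\<in>carrier G. \<sigma> (inv g) (p (\<sigma> g x))) = (\<Sum>g\<in>carrier G. x)"
      using that XV actX p_id by (intro sum.cong) auto
    then show ?thesis
      using char by (simp add: avg_def sum_constant_scale order_def flip: order_def)
  qed
  have avg_add: "avg (u + w) = avg u + avg w" if "u \<in> V" "w \<in> V" for u w
  proof -
    have "\<sigma> (inv g) (p (\<sigma> g (u + w))) = \<sigma> (inv g) (p (\<sigma> g u)) + \<sigma> (inv g) (p (\<sigma> g w))" if "g \<in> carrier G" for g
      using that \<open>u \<in> V\<close> \<open>w \<in> V\<close> pX XV by (simp add: act_add p.add subset_iff)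
    then show ?thesis by (simp add: avg_def sum.distrib scale_right_distrib)
  qed
  have avg_scale: "avg (s c u) = s c (avg u)" if "u \<in> V" for c u
  proof -
    have "\<sigma> (inv g) (p (\<sigma> g (s c u))) = s c (\<sigma> (inv g) (p (\<sigma> g u)))" if "g \<in> carrier G" for g
      using that \<open>u \<in> V\<close> pX XV by (simp add: act_scale p.scale subset_iff)
    then show ?thesis by (simp add: avg_def mult.commute flip: scale_sum_right)
  qed
  have avg_act: "avg (\<sigma> k u) = \<sigma> k (avg u)" if k: "k \<in> carrier G" and u: "u \<in> V" for k u
  proof -
    have inV: "\<sigma> (inv g) (p (\<sigma> g u)) \<in> V" if "g \<in> carrier G" for g
      using that pX XV by (simp add: subset_iff)
    \<comment> \<open>equivariance is the substitution of \<open>g k\<close> for \<open>g\<close> in the average\<close>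
    have bij: "bij_betw (\<lambda>g. g \<otimes> k) (carrier G) (carrier G)"
      using k by (intro bij_betwI[where g = "\<lambda>g. g \<otimes> inv k"]) (auto simp: m_assoc)
    have "(\<Sum>g\<in>carrier G. \<sigma> (inv g) (p (\<sigma> g (\<sigma> k u)))) =
        (\<Sum>g\<in>carrier G. \<sigma> k (\<sigma> (inv (g \<otimes> k)) (p (\<sigma> (g \<otimes> k) u))))"
      using k u pX XV by (intro sum.cong) (auto simp: inv_mult_group act_mult subset_iff)
    also have "\<dots> = (\<Sum>g\<in>carrier G. \<sigma> k (\<sigma> (inv g) (p (\<sigma> g u))))"
      by (rule sum.reindex_bij_betw[OF bij])
    also have "\<dots> = \<sigma> k (\<Sum>g\<in>carrier G. \<sigma> (inv g) (p (\<sigma> g u)))"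
      by (rule act_sum[symmetric, OF k inV])
    finally show ?thesis
      using act_scale[OF k subspace_sum[OF subspace_V, of "carrier G", OF inV]] by (simp add: avg_def)
  qed
  define Y where "Y = {u \<in> V. avg u = 0}"
  have avgV: "avg u \<in> V" for u using avgX XV by blast
  have zero: "avg 0 = 0" using avg_id subspace_0[OF subX] by blast
  have "subspace Y"
    using subspace_V avg_add avg_scale zero by (auto simp: subspace_def Y_def)
  then have "invariant_subspace s G V \<sigma> Y"
    using avg_act by (auto simp: invariant_subspace_def Y_def)
  moreover have "X \<inter> Y = {0}"
    using avg_id subspace_0[OF subX] subspace_0[OF subspace_V] zero by (auto simp: Y_def)
  moreover have "V = {x + y | x y. x \<in> X \<and> y \<in> Y}"
  proof
    show "{x + y | x y. x \<in> X \<and> y \<in> Y} \<subseteq> V"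
      using XV subspace_add[OF subspace_V] by (auto simp: Y_def)
    show "V \<subseteq> {x + y | x y. x \<in> X \<and> y \<in> Y}"
    proof
      fix u assume u: "u \<in> V"
      have d: "u - avg u \<in> V" using u avgV by (rule subspace_diff[OF subspace_V])
      have "avg u = avg (avg u + (u - avg u))" by simp
      also have "\<dots> = avg u + avg (u - avg u)"
        by (simp only: avg_add[OF avgV d] avg_id[OF avgX])
      finally have "avg (u - avg u) = 0" by (simp only: add_cancel_right_right)
      then have "u - avg u \<in> Y" using d by (simp add: Y_def)
      moreover have "u = avg u + (u - avg u)" by simp
      ultimately show "u \<in> {x + y | x y. x \<in> X \<and> y \<in> Y}" using avgX by blast
    qed
  qed
  ultimately show ?thesis by blast
qed

lemma dim_less:
  assumes "subspace W" "S \<subseteq> V" "W \<subset> S"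
  shows "dim W < dim S"
proof -
  obtain B where B: "finite B" "V = span B" using finite_dim by blast
  obtain C where C: "C \<subseteq> W" "independent C" "W \<subseteq> span C"
    using maximal_independent_subset by blast
  obtain D where D: "C \<subseteq> D" "D \<subseteq> S" "independent D" "S \<subseteq> span D"
    using maximal_independent_subset_extend[of C S] C assms by blast
  have "finite D" using independent_span_bound[OF B(1) D(3)] D(2) assms(2) B(2) by blast
  moreover have "C \<noteq> D"
    using span_minimal[OF C(1) assms(1)] D(4) assms(3) by blast
  ultimately have "card C < card D" using D(1) by (intro psubset_card_mono) auto
  then show ?thesis using basis_card_eq_dim C D by metis
qed

lemma linear_rep_subrep:
  assumes "invariant_subspace s G V \<sigma> S"
  shows "linear_rep s G S (subrep \<sigma> S)"
proof
  have SV: "S \<subseteq> V" and subS: "subspace S" and actS: "\<And>g x. g \<in> carrier G \<Longrightarrow> x \<in> S \<Longrightarrow> \<sigma> g x \<in> S"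
    using assms by (auto simp: invariant_subspace_def)
  obtain B where B: "finite B" "V = span B" using finite_dim by blast
  obtain C where C: "C \<subseteq> S" "independent C" "S \<subseteq> span C"
    using maximal_independent_subset by blast
  have "finite C" using independent_span_bound[OF B(1) C(2)] C(1) SV B(2) by blast
  moreover have "S = span C" using C span_minimal[OF C(1) subS] by blast
  ultimately show "\<exists>C. finite C \<and> S = span C" by blast
  have "bij_betw (restrict (\<sigma> g) S) S S" if g: "g \<in> carrier G" for g
    using g SV actS by (intro bij_betwI[where g = "\<sigma> (inv g)"]) (auto simp: subset_iff)
  then have "restrict (\<sigma> g) S \<in> carrier (GL s S)" if g: "g \<in> carrier G" for g
    using g SV act_add[OF g] act_scale[OF g] subspace_add[OF subS] subspace_scale[OF subS]
    by (auto simp: GL_def Bij_def linear_on_def subset_iff)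
  moreover have "restrict (\<sigma> (g \<otimes> k)) S = compose S (restrict (\<sigma> g) S) (restrict (\<sigma> k) S)"
    if "g \<in> carrier G" "k \<in> carrier G" for g k
    using that SV actS act_mult by (auto simp: compose_def fun_eq_iff subset_iff)
  ultimately show "subrep \<sigma> S \<in> hom G (GL s S)"
    by (auto simp: hom_def subrep_def GL_def BijGroup_def)
qed

text \<open>
  A nonzero invariant subspace of least dimension inside \<open>Y\<close> is irreducible.
\<close>

proposition exists_irreducible_constituent:
  assumes fin: "finite (carrier G)" and char: "of_nat (order G) \<noteq> (0::'f)"
    and Y: "invariant_subspace s G V \<sigma> Y" "Y \<noteq> {0}"
  shows "\<exists>S\<subseteq>Y. irreducible_constituent s G V \<sigma> S"
proof -
  define P where "P S \<longleftrightarrow> invariant_subspace s G V \<sigma> S \<and> S \<noteq> {0} \<and> S \<subseteq> Y" for S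
  have "\<exists>S. P S \<and> (\<forall>W. P W \<longrightarrow> dim S \<le> dim W)"
    by (rule ex_has_least_nat[of P Y dim]) (use Y in \<open>simp add: P_def\<close>)
  then obtain S where S: "P S" and min: "\<And>W. P W \<Longrightarrow> dim S \<le> dim W" by blast
  have inv: "invariant_subspace s G V \<sigma> S" and SV: "S \<subseteq> V"
    using S by (auto simp: P_def invariant_subspace_def)
  have "W = {0} \<or> W = S" if W: "invariant_subspace s G S (subrep \<sigma> S) W" for W
  proof (rule ccontr)
    assume not: "\<not> (W = {0} \<or> W = S)"
    have "W \<subseteq> S" "subspace W" using W by (auto simp: invariant_subspace_def)
    moreover have "P W"
      using W not S SV by (auto simp: P_def invariant_subspace_def subrep_def subset_iff)
    ultimately show False using min[of W] dim_less[of W S] not SV by auto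
  qed
  then have "irreducible_rep s G S (subrep \<sigma> S)"
    using linear_rep_subrep[OF inv] S by (simp add: irreducible_rep_def P_def)
  then show ?thesis
    using inv invariant_complement[OF fin char inv] S
    unfolding irreducible_constituent_def P_def by blast
qed

end

section \<open>Fixed spaces and kernels\<close>

context linear_rep
begin

definition fixed_space :: "'g set \<Rightarrow> 'v set" where
  "fixed_space N = {u \<in> V. \<forall>n\<in>N. \<sigma> n u = u}"

definition kernel_on :: "'v set \<Rightarrow> 'g set" where
  "kernel_on S = {g \<in> carrier G. \<forall>u\<in>S. \<sigma> g u = u}"

lemma invariant_subspace_fixed_space:
  assumes "N \<lhd> G"
  shows "invariant_subspace s G V \<sigma> (fixed_space N)"
proof -
  interpret N: normal N G by fact
  have NG: "n \<in> carrier G" if "n \<in> N" for n using that by (rule N.mem_carrier)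
  have "\<sigma> n (\<sigma> g u) = \<sigma> g u" if g: "g \<in> carrier G" and u: "u \<in> fixed_space N" and n: "n \<in> N" for g u n
  proof -
    have m: "inv g \<otimes> n \<otimes> g \<in> N" using N.inv_op_closed1[OF g n] .
    have uV: "u \<in> V" using u by (simp add: fixed_space_def)
    have "\<sigma> n (\<sigma> g u) = \<sigma> (g \<otimes> (inv g \<otimes> n \<otimes> g)) u"
      using g NG[OF n] uV by (simp add: act_mult flip: m_assoc)
    also have "\<dots> = \<sigma> g (\<sigma> (inv g \<otimes> n \<otimes> g) u)"
      using g NG[OF m] uV by (rule act_mult)
    also have "\<sigma> (inv g \<otimes> n \<otimes> g) u = u" using u m by (simp add: fixed_space_def)
    finally show ?thesis .
  qed
  moreover have "subspace (fixed_space N)"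
    using subspace_V act_add[OF NG] act_scale[OF NG] act_zero[OF NG]
    by (auto simp: subspace_def fixed_space_def)
  ultimately show ?thesis by (auto simp: invariant_subspace_def fixed_space_def)
qed

lemma normal_kernel_on:
  assumes S: "invariant_subspace s G V \<sigma> S"
  shows "kernel_on S \<lhd> G"
proof -
  have SV: "u \<in> V" if "u \<in> S" for u using S that by (auto simp: invariant_subspace_def)
  have actS: "\<sigma> g u \<in> S" if "g \<in> carrier G" "u \<in> S" for g u using S that by (auto simp: invariant_subspace_def)
  have "subgroup (kernel_on S) G"
  proof (rule subgroupI)
    have "\<one> \<in> kernel_on S" by (simp add: kernel_on_def SV)
    then show "kernel_on S \<noteq> {}" by blast
    show "inv a \<in> kernel_on S" if "a \<in> kernel_on S" for a
    proof -
      have "\<sigma> (inv a) u = u" if u: "u \<in> S" for u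
      proof -
        have a: "a \<in> carrier G" "\<sigma> a u = u" using \<open>a \<in> kernel_on S\<close> u by (auto simp: kernel_on_def)
        show ?thesis using act_inv(1)[OF a(1) SV[OF u]] unfolding a(2) .
      qed
      then show ?thesis using that by (simp add: kernel_on_def)
    qed
  qed (auto simp: kernel_on_def act_mult SV)
  moreover have "x \<otimes> h \<otimes> inv x \<in> kernel_on S" if x: "x \<in> carrier G" and h: "h \<in> kernel_on S" for x h
  proof -
    have "\<sigma> (x \<otimes> h \<otimes> inv x) u = u" if u: "u \<in> S" for u
    proof -
      have "\<sigma> h (\<sigma> (inv x) u) = \<sigma> (inv x) u" using h x u actS by (simp add: kernel_on_def)
      then show ?thesis using h x u SV by (simp add: kernel_on_def act_mult)
    qed
    then show ?thesis using x h by (simp add: kernel_on_def)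
  qed
  ultimately show ?thesis by (simp add: normal_inv_iff)
qed

lemma orbit_sum_in_fixed_space:
  assumes N: "subgroup N G" and u: "u \<in> V"
  shows "(\<Sum>n\<in>N. \<sigma> n u) \<in> fixed_space N"
proof -
  have NG: "n \<in> carrier G" if "n \<in> N" for n using N that by (rule subgroup.mem_carrier)
  have inV: "\<sigma> n u \<in> V" if "n \<in> N" for n using NG that u by simp
  have "\<sigma> m (\<Sum>n\<in>N. \<sigma> n u) = (\<Sum>n\<in>N. \<sigma> n u)" if m: "m \<in> N" for m
  proof -
    have "bij_betw (\<lambda>n. m \<otimes> n) N N"
      using m NG N
      by (intro bij_betwI[where g = "\<lambda>n. inv m \<otimes> n"])
        (auto simp: subgroup.m_closed subgroup.m_inv_closed simp flip: m_assoc)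
    then have "(\<Sum>n\<in>N. \<sigma> (m \<otimes> n) u) = (\<Sum>n\<in>N. \<sigma> n u)"
      by (rule sum.reindex_bij_betw)
    moreover have "\<sigma> m (\<Sum>n\<in>N. \<sigma> n u) = (\<Sum>n\<in>N. \<sigma> (m \<otimes> n) u)"
      using act_sum[OF NG[OF m] inV, of N] u NG m by (simp add: act_mult)
    ultimately show ?thesis by simp
  qed
  then show ?thesis using subspace_sum[OF subspace_V inV, of N] by (simp add: fixed_space_def)
qed

lemma commutator_acts_trivially:
  assumes h: "h \<in> hom_center G (GL s V) \<sigma>" and g: "g \<in> carrier G" and u: "u \<in> V"
  shows "\<sigma> (commutator G g h) u = u"
proof -
  have hG: "h \<in> carrier G" using h by (simp add: hom_center_def)
  have "\<sigma> h \<otimes>\<^bsub>GL s V\<^esub> \<sigma> g = \<sigma> g \<otimes>\<^bsub>GL s V\<^esub> \<sigma> h"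
    using h g by (simp add: hom_center_def group_center_def)
  then have eq: "\<sigma> (h \<otimes> g) = \<sigma> (g \<otimes> h)"
    using hom_GL hG g by (simp add: hom_def)
  have "commutator G g h = (g \<otimes> h) \<otimes> inv (h \<otimes> g)"
    using g hG by (simp add: commutator_def inv_mult_group m_assoc)
  then have "\<sigma> (commutator G g h) u = \<sigma> (g \<otimes> h) (\<sigma> (inv (h \<otimes> g)) u)"
    using act_mult[of "g \<otimes> h" "inv (h \<otimes> g)" u] g hG u by simp
  also have "\<dots> = u" using act_inv(2)[of "h \<otimes> g" u] g hG u by (simp add: eq)
  finally show ?thesis .
qed

text \<open>
  The operator \<open>(1 - g\<^sub>1) \<dots> (1 - g\<^sub>r)\<close> of the group algebra.
\<close>

definition diff_op :: "'g list \<Rightarrow> 'v \<Rightarrow> 'v" where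
  "diff_op gs u = foldr (\<lambda>g w. w - \<sigma> g w) gs u"

lemma diff_op_simps [simp]:
  "diff_op [] u = u" "diff_op (g # gs) u = diff_op gs u - \<sigma> g (diff_op gs u)"
  by (simp_all add: diff_op_def)

lemma diff_op_closed:
  assumes "set gs \<subseteq> carrier G" "invariant_subspace s G V \<sigma> X" "u \<in> X"
  shows "diff_op gs u \<in> X"
  using assms by (induction gs) (auto simp: invariant_subspace_def intro: subspace_diff)

lemma diff_op_add:
  assumes "set gs \<subseteq> carrier G" "u \<in> V" "w \<in> V"
  shows "diff_op gs (u + w) = diff_op gs u + diff_op gs w"
  using assms
proof (induction gs)
  case (Cons g gs)
  then show ?case
    using diff_op_closed[OF _ invariant_subspace_whole, of gs] by (simp add: act_add)
qed simp

lemma diff_op_scale: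
  assumes "set gs \<subseteq> carrier G" "u \<in> V"
  shows "diff_op gs (s c u) = s c (diff_op gs u)"
  using assms
proof (induction gs)
  case (Cons g gs)
  then show ?case
    using diff_op_closed[OF _ invariant_subspace_whole, of gs] by (simp add: act_scale scale_right_diff_distrib)
qed simp

text \<open>
  The factor \<open>1 - g\<close> kills the vectors fixed by \<open>N\<close>, and the factors to its right preserve the space of
  these vectors because \<open>N\<close> is normal.
\<close>

lemma diff_op_eq_zero:
  assumes "set gs \<subseteq> carrier G" "N \<lhd> G" "g \<in> set gs" "g \<in> N" "u \<in> fixed_space N"
  shows "diff_op gs u = 0"
  using assms
proof (induction gs)
  case (Cons k gs)
  show ?case
  proof (cases "g = k")
    case True
    have "diff_op gs u \<in> fixed_space N"
      using Cons.prems by (intro diff_op_closed invariant_subspace_fixed_space) auto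
    then show ?thesis using True Cons.prems by (simp add: fixed_space_def)
  next
    case False
    then show ?thesis using Cons by simp
  qed
qed simp

text \<open>
  Let \<open>X\<close> be the sum of the spaces fixed by the members of \<open>Ds\<close>. The product of the \<open>1 - n D\<close> kills \<open>X\<close>
  but not \<open>u\<close>, so a complement of \<open>X\<close> contains nonzero vectors fixed by \<open>L\<close>. An
  irreducible subspace consisting of such vectors meets \<open>X\<close> trivially.
\<close>

lemma exists_constituent_avoiding:
  assumes fin: "finite (carrier G)" and char: "of_nat (order G) \<noteq> (0::'f)"
    and L: "L \<lhd> G" and D: "\<And>D. D \<in> set Ds \<Longrightarrow> D \<lhd> G \<and> L \<subseteq> D \<and> n D \<in> D"
    and u: "u \<in> fixed_space L" "diff_op (map n Ds) u \<noteq> 0"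
  shows "\<exists>S. irreducible_constituent s G V \<sigma> S \<and> S \<subseteq> fixed_space L \<and> (\<forall>D\<in>set Ds. \<not> S \<subseteq> fixed_space D)"
proof -
  have nG: "set (map n Ds) \<subseteq> carrier G"
    using D by (auto dest!: normal_imp_subgroup subgroup.subset)
  have invL: "invariant_subspace s G V \<sigma> (fixed_space L)" using L by (rule invariant_subspace_fixed_space)
  define X where "X = span (\<Union>D\<in>set Ds. fixed_space D)"
  have inv: "invariant_subspace s G V \<sigma> (fixed_space D)" if "D \<in> set Ds" for D
    using D[OF that] by (blast intro: invariant_subspace_fixed_space)
  have sub: "fixed_space D \<subseteq> fixed_space L" if "D \<in> set Ds" for D
    using D[OF that] by (auto simp: fixed_space_def)
  have XL: "X \<subseteq> fixed_space L" unfolding X_def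
    using sub invL by (intro span_minimal) (auto simp: invariant_subspace_def)
  have LV: "fixed_space L \<subseteq> V" by (auto simp: fixed_space_def)
  have XV: "X \<subseteq> V" using XL LV by blast
  have subX: "subspace X" by (simp add: X_def)
  have "x \<in> V \<and> \<sigma> g x \<in> X" if g: "g \<in> carrier G" and x: "x \<in> X" for g x
    using x unfolding X_def
  proof (induction rule: span_induct_alt)
    case base
    then show ?case using g span_zero subspace_0[OF subspace_V] by simp
  next
    case (step c y z)
    have y: "y \<in> V" "\<sigma> g y \<in> (\<Union>D\<in>set Ds. fixed_space D)"
      using step inv g by (auto simp: invariant_subspace_def)
    have cy: "s c y \<in> V" using y(1) by (rule subspace_scale[OF subspace_V])
    have "\<sigma> g (s c y + z) = s c (\<sigma> g y) + \<sigma> g z"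
      using g y step cy by (simp add: act_add act_scale)
    then show ?case
      using step y cy subspace_add[OF subspace_V] by (auto intro: span_add span_scale span_base)
  qed
  then have invX: "invariant_subspace s G V \<sigma> X"
    using XV subX by (simp add: invariant_subspace_def)
  have "x \<in> V \<and> diff_op (map n Ds) x = 0" if "x \<in> X" for x
    using that unfolding X_def
  proof (induction rule: span_induct_alt)
    case base
    show ?case
      using diff_op_scale[OF nG subspace_0[OF subspace_V], of 0] subspace_0[OF subspace_V] by simp
  next
    case (step c y z)
    then obtain D' where D': "D' \<in> set Ds" "y \<in> fixed_space D'" by blast
    have "diff_op (map n Ds) y = 0"
      using D[OF D'(1)] D' nG by (intro diff_op_eq_zero[of _ D' "n D'"]) auto
    moreover have y: "y \<in> V" using D' by (simp add: fixed_space_def)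
    moreover have cy: "s c y \<in> V" using y by (rule subspace_scale[OF subspace_V])
    ultimately show ?case
      using step diff_op_add[OF nG cy] diff_op_scale[OF nG y] subspace_add[OF subspace_V cy] by simp
  qed
  then have kill: "diff_op (map n Ds) x = 0" if "x \<in> X" for x using that by blast
  obtain C where C: "invariant_subspace s G V \<sigma> C" "X \<inter> C = {0}" "V = {x + y | x y. x \<in> X \<and> y \<in> C}"
    using invariant_complement[OF fin char invX] by blast
  have "u \<in> V" using u LV by blast
  then obtain x c where xc: "u = x + c" "x \<in> X" "c \<in> C" using C(3) by blast
  have subL: "subspace (fixed_space L)" using invL by (simp add: invariant_subspace_def)
  \<comment> \<open>\<open>x\<close> is fixed by \<open>L\<close> as well, since \<open>L\<close> is contained in every \<open>D\<close>\<close>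
  have "c = u - x" using xc by simp
  then have cL: "c \<in> fixed_space L" using subspace_diff[OF subL] u xc XL by blast
  have "c \<noteq> 0" using kill xc u by auto
  have "invariant_subspace s G V \<sigma> (C \<inter> fixed_space L)"
    using C(1) invL subspace_inter by (auto simp: invariant_subspace_def)
  moreover have "C \<inter> fixed_space L \<noteq> {0}" using \<open>c \<noteq> 0\<close> cL xc by blast
  ultimately obtain S where S: "S \<subseteq> C \<inter> fixed_space L" "irreducible_constituent s G V \<sigma> S"
    using exists_irreducible_constituent[OF fin char] by blast
  have "\<not> S \<subseteq> fixed_space D" if "D \<in> set Ds" for D
  proof
    assume "S \<subseteq> fixed_space D"
    then have "S \<subseteq> X \<inter> C" using S(1) that span_base unfolding X_def by blast
    moreover have "S \<noteq> {0}" "0 \<in> S"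
      using S(2) subspace_0 by (auto simp: irreducible_constituent_def irreducible_rep_def invariant_subspace_def)
    ultimately show False using C(2) by blast
  qed
  then show ?thesis using S by blast
qed

end

section \<open>Central elements in a faithful irreducible representation\<close>

text \<open>
  The sum is fixed by \<open>z\<close>. As \<open>z\<close> is central, its fixed vectors form an invariant subspace, which is not
  all of \<open>V\<close> because \<open>z\<close> acts nontrivially.
\<close>

lemma irreducible_faithful_power_sum:
  assumes irr: "irreducible_rep s K V \<rho>" and faith: "faithful_rep K \<rho>"
    and z: "z \<in> group_center K" "z [^]\<^bsub>K\<^esub> (n::nat) = \<one>\<^bsub>K\<^esub>" "z \<noteq> \<one>\<^bsub>K\<^esub>" and w: "w \<in> V"
  shows "(\<Sum>j<n. \<rho> (z [^]\<^bsub>K\<^esub> j) w) = 0"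
proof -
  interpret linear_rep s K V \<rho> using irr by (simp add: irreducible_rep_def)
  have zK: "z \<in> carrier K" and comm: "\<And>g. g \<in> carrier K \<Longrightarrow> z \<otimes>\<^bsub>K\<^esub> g = g \<otimes>\<^bsub>K\<^esub> z"
    using z by (auto simp: group_center_def)
  define X where "X = {u \<in> V. \<rho> z u = u}"
  have "\<rho> z (\<rho> g u) = \<rho> g u" if "g \<in> carrier K" "u \<in> X" for g u
    using act_mult[of z g u] act_mult[of g z u] comm[of g] that zK by (simp add: X_def)
  then have "invariant_subspace s K V \<rho> X"
    using subspace_V act_add[OF zK] act_scale[OF zK] act_zero[OF zK]
    by (auto simp: invariant_subspace_def subspace_def X_def)
  moreover have "X \<noteq> V"
  proof
    assume "X = V"
    then have "\<forall>u\<in>V. \<rho> z u = \<rho> \<one>\<^bsub>K\<^esub> u" using act_one unfolding X_def by auto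
    then have "\<rho> z = \<rho> \<one>\<^bsub>K\<^esub>" using act_eq_iff[OF zK one_closed] by blast
    then show False using faith z(3) zK inj_onD[of \<rho> "carrier K" z "\<one>\<^bsub>K\<^esub>"] by (simp add: faithful_rep_def)
  qed
  ultimately have X: "X = {0}" using irr by (auto simp: irreducible_rep_def)
  have inV: "\<rho> (z [^]\<^bsub>K\<^esub> (j::nat)) w \<in> V" for j using zK w by simp
  have step: "\<rho> z (\<rho> (z [^]\<^bsub>K\<^esub> j) w) = \<rho> (z [^]\<^bsub>K\<^esub> Suc j) w" for j :: nat
    using act_mult[of z "z [^]\<^bsub>K\<^esub> j" w] zK w by (simp only: nat_pow_Suc2 nat_pow_closed)
  have "\<rho> z (\<Sum>j<n. \<rho> (z [^]\<^bsub>K\<^esub> j) w) = (\<Sum>j<n. \<rho> (z [^]\<^bsub>K\<^esub> Suc j) w)"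
    by (simp only: act_sum[OF zK inV] step)
  also have "\<dots> = (\<Sum>j<n. \<rho> (z [^]\<^bsub>K\<^esub> j) w)"
  proof -
    have "(\<Sum>j<Suc n. \<rho> (z [^]\<^bsub>K\<^esub> j) w) = w + (\<Sum>j<n. \<rho> (z [^]\<^bsub>K\<^esub> Suc j) w)"
      using w by (simp only: sum.lessThan_Suc_shift nat_pow_0 act_one)
    moreover have "(\<Sum>j<Suc n. \<rho> (z [^]\<^bsub>K\<^esub> j) w) = (\<Sum>j<n. \<rho> (z [^]\<^bsub>K\<^esub> j) w) + w"
      using w by (simp only: sum.lessThan_Suc z(2) act_one)
    ultimately show ?thesis by (metis add.commute add_left_cancel)
  qed
  finally have "(\<Sum>j<n. \<rho> (z [^]\<^bsub>K\<^esub> j) w) \<in> X"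
    using subspace_sum[OF subspace_V inV] by (simp add: X_def)
  then show ?thesis using X by blast
qed

text \<open>
  In a field the \<open>n\<close>-th roots of unity are the powers of one that is primitive, and by Schur's lemma the central
  elements act through a field. Fourier inversion gives a direct argument: if no \<open>z j = x\<^sup>-\<^sup>j y\<close> is \<open>1\<close>,
  the sum over \<open>i < n\<close> of the powers \<open>(z j)\<^sup>i\<close> acts as \<open>0\<close> for every \<open>j\<close>. Summing these over \<open>j\<close> instead
  first leaves only the term with \<open>i = 0\<close>, which is \<open>n\<close> times the identity.
\<close>

lemma central_root_of_unity_is_power:
  fixes n :: nat
  assumes irr: "irreducible_rep (s :: 'f::field \<Rightarrow> 'v::ab_group_add \<Rightarrow> 'v) K V \<rho>" and faith: "faithful_rep K \<rho>"
    and x: "x \<in> group_center K" "x [^]\<^bsub>K\<^esub> n = \<one>\<^bsub>K\<^esub>" "\<And>i. 0 < i \<Longrightarrow> i < n \<Longrightarrow> x [^]\<^bsub>K\<^esub> i \<noteq> \<one>\<^bsub>K\<^esub>"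
    and y: "y \<in> group_center K" "y [^]\<^bsub>K\<^esub> n = \<one>\<^bsub>K\<^esub>" and n: "of_nat n \<noteq> (0::'f)"
  shows "\<exists>j::nat. y = x [^]\<^bsub>K\<^esub> j"
proof (rule ccontr)
  assume not: "\<nexists>j::nat. y = x [^]\<^bsub>K\<^esub> j"
  interpret linear_rep s K V \<rho> using irr by (simp add: irreducible_rep_def)
  have cK: "c \<in> carrier K" if "c \<in> group_center K" for c using that by (simp add: group_center_def)
  have xK: "x \<in> carrier K" and yK: "y \<in> carrier K" using x y cK by auto
  define x' where "x' = inv\<^bsub>K\<^esub> x"
  have x'Z: "x' \<in> group_center K"
    unfolding x'_def using subgroup.m_inv_closed[OF subgroup_group_center x(1)] .
  have x'K: "x' \<in> carrier K" using cK x'Z .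
  have commxy: "x' \<otimes>\<^bsub>K\<^esub> y = y \<otimes>\<^bsub>K\<^esub> x'" using x'Z yK by (simp add: group_center_def)
  define z where "z j = x' [^]\<^bsub>K\<^esub> (j::nat) \<otimes>\<^bsub>K\<^esub> y" for j
  have zZ: "z j \<in> group_center K" for j
    unfolding z_def
    by (intro subgroup.m_closed[OF subgroup_group_center] subgroup_nat_pow_closed[OF subgroup_group_center] x'Z y)
  have commp: "x' [^]\<^bsub>K\<^esub> j \<otimes>\<^bsub>K\<^esub> y = y \<otimes>\<^bsub>K\<^esub> x' [^]\<^bsub>K\<^esub> j" for j :: nat
    using group_commutes_pow[OF commxy x'K yK] .
  have z_pow: "z j [^]\<^bsub>K\<^esub> i = (x' [^]\<^bsub>K\<^esub> i) [^]\<^bsub>K\<^esub> j \<otimes>\<^bsub>K\<^esub> y [^]\<^bsub>K\<^esub> i" for i j :: nat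
    unfolding z_def using pow_mult_distrib[OF commp _ yK] x'K by (simp add: nat_pow_pow mult.commute)
  have x'n: "x' [^]\<^bsub>K\<^esub> n = \<one>\<^bsub>K\<^esub>" using x(2) xK by (simp add: x'_def nat_pow_inv)
  have zn: "z j [^]\<^bsub>K\<^esub> n = \<one>\<^bsub>K\<^esub>" for j by (simp add: z_pow x'n y(2))
  have z1: "z j \<noteq> \<one>\<^bsub>K\<^esub>" for j
  proof
    assume "z j = \<one>\<^bsub>K\<^esub>"
    then have "inv\<^bsub>K\<^esub> (x [^]\<^bsub>K\<^esub> j) \<otimes>\<^bsub>K\<^esub> y = \<one>\<^bsub>K\<^esub>" using xK by (simp add: z_def x'_def nat_pow_inv)
    then have "y = x [^]\<^bsub>K\<^esub> j" using xK yK by (metis inv_closed inv_equality inv_inv nat_pow_closed inv_comm)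
    then show False using not by blast
  qed
  have "V \<noteq> {0}" using irr by (simp add: irreducible_rep_def)
  then obtain w where w: "w \<in> V" "w \<noteq> 0" using subspace_0[OF subspace_V] by blast
  have "0 = (\<Sum>j<n. \<Sum>i<n. \<rho> (z j [^]\<^bsub>K\<^esub> i) w)"
    by (simp add: irreducible_faithful_power_sum[OF irr faith zZ zn z1 w(1)])
  also have "\<dots> = (\<Sum>i<n. \<Sum>j<n. \<rho> (z j [^]\<^bsub>K\<^esub> i) w)" by (rule sum.swap)
  also have "\<dots> = (\<Sum>i<n. if i = 0 then s (of_nat n) w else 0)"
  proof (rule sum.cong[OF refl])
    fix i assume i: "i \<in> {..<n}"
    have e: "(\<Sum>j<n. \<rho> (z j [^]\<^bsub>K\<^esub> i) w) = (\<Sum>j<n. \<rho> ((x' [^]\<^bsub>K\<^esub> i) [^]\<^bsub>K\<^esub> j) (\<rho> (y [^]\<^bsub>K\<^esub> i) w))"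
      unfolding z_pow using x'K yK w by (intro sum.cong refl act_mult) auto
    show "(\<Sum>j<n. \<rho> (z j [^]\<^bsub>K\<^esub> i) w) = (if i = 0 then s (of_nat n) w else 0)"
    proof (cases "i = 0")
      case True
      then show ?thesis using e w by (simp add: sum_constant_scale)
    next
      case False
      have 1: "x' [^]\<^bsub>K\<^esub> i \<in> group_center K" using subgroup_nat_pow_closed[OF subgroup_group_center x'Z] .
      have 2: "(x' [^]\<^bsub>K\<^esub> i) [^]\<^bsub>K\<^esub> n = \<one>\<^bsub>K\<^esub>"
        using x'K x'n by (simp add: nat_pow_pow mult.commute[of i]) (simp flip: nat_pow_pow)
      have "x [^]\<^bsub>K\<^esub> i \<noteq> \<one>\<^bsub>K\<^esub>" using x(3) i False by simp
      then have 3: "x' [^]\<^bsub>K\<^esub> i \<noteq> \<one>\<^bsub>K\<^esub>" using xK by (simp add: x'_def nat_pow_inv)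
      have "\<rho> (y [^]\<^bsub>K\<^esub> i) w \<in> V" using yK w by simp
      then show ?thesis using e irreducible_faithful_power_sum[OF irr faith 1 2 3] False by simp
    qed
  qed
  also have "\<dots> = s (of_nat n) w" using n by (cases n) auto
  finally show False using n w by simp
qed

section \<open>Constituents of the induced representation\<close>

locale faithful_induction =
  R: linear_rep s "G\<lparr>carrier := H\<rparr>" V \<rho> + G: group G
  for s :: "'f::field \<Rightarrow> 'v::ab_group_add \<Rightarrow> 'v" and G :: "('g, 'b) monoid_scheme" (structure)
    and H V \<rho> +
  assumes finite_carrier: "finite (carrier G)" and subgroup_H: "subgroup H G"
    and irreducible: "irreducible_rep s (G\<lparr>carrier := H\<rparr>) V \<rho>"
    and faithful: "faithful_rep (G\<lparr>carrier := H\<rparr>) \<rho>"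
begin

abbreviation U where "U \<equiv> induced_space G H V \<rho>"
abbreviation \<tau> where "\<tau> \<equiv> induced_rep G H V \<rho>"

sublocale I: linear_rep "fun_scale s" G U \<tau>
  by (rule linear_rep_induced[OF G.is_group finite_carrier subgroup_H R.linear_rep_axioms])

lemma mem_H_carrier: "h \<in> H \<Longrightarrow> h \<in> carrier G"
  using subgroup_H by (rule subgroup.mem_carrier)

lemma inv_mem_H: "h \<in> H \<Longrightarrow> inv h \<in> H"
  using subgroup_H by (rule subgroup.m_inv_closed)

lemma induced_apply: "f \<in> U \<Longrightarrow> x \<in> carrier G \<Longrightarrow> \<tau> g f x = f (inv g \<otimes> x)"
  by (simp add: induced_rep_def)

lemma rho_mult: "h \<in> H \<Longrightarrow> k \<in> H \<Longrightarrow> v \<in> V \<Longrightarrow> \<rho> (h \<otimes> k) v = \<rho> h (\<rho> k v)"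
  using R.act_mult by simp

text \<open>
  This is Frobenius reciprocity: the values at \<open>\<one>\<close> of the functions in \<open>S\<close> form a nonzero \<open>H\<close>-invariant
  subspace of \<open>V\<close>, hence all of \<open>V\<close>, and \<open>k\<close> acts trivially on them.
\<close>

lemma restriction_faithful:
  assumes S: "invariant_subspace (fun_scale s) G U \<tau> S" "S \<noteq> {0}"
    and k: "k \<in> H" "k \<in> I.kernel_on S"
  shows "k = \<one>"
proof -
  have SU: "f \<in> U" if "f \<in> S" for f using S that by (auto simp: invariant_subspace_def)
  have actS: "\<tau> g f \<in> S" if "g \<in> carrier G" "f \<in> S" for g f using S that by (auto simp: invariant_subspace_def)
  have subS: "I.subspace S" using S by (simp add: invariant_subspace_def)
  define X where "X = (\<lambda>f. f \<one>) ` S"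
  have val: "f \<one> \<in> V" if "f \<in> S" for f using SU[OF that] by (simp add: induced_space_def)
  have act1: "\<rho> h (f \<one>) = \<tau> h f \<one>" if "h \<in> H" "f \<in> S" for h f
  proof -
    have "f (\<one> \<otimes> inv h) = \<rho> (inv (inv h)) (f \<one>)"
      using SU[OF that(2)] inv_mem_H[OF that(1)] unfolding induced_space_def by blast
    then show ?thesis using induced_apply[OF SU[OF that(2)], of \<one> h] mem_H_carrier[OF that(1)] by simp
  qed
  have "R.subspace X"
  proof (rule R.subspaceI)
    show "0 \<in> X" unfolding X_def using I.subspace_0[OF subS] by (rule rev_image_eqI) simp
    show "x + y \<in> X" if xy: "x \<in> X" "y \<in> X" for x y
    proof -
      obtain f k where fk: "f \<in> S" "k \<in> S" "x = f \<one>" "y = k \<one>" using xy unfolding X_def by blast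
      show ?thesis unfolding X_def using I.subspace_add[OF subS fk(1,2)] by (rule rev_image_eqI) (simp add: fk)
    qed
    show "s c x \<in> X" if x: "x \<in> X" for x c
    proof -
      obtain f where f: "f \<in> S" "x = f \<one>" using x unfolding X_def by blast
      show ?thesis unfolding X_def
        using I.subspace_scale[OF subS f(1), of c] by (rule rev_image_eqI) (simp add: f fun_scale_def)
    qed
  qed
  moreover have "\<rho> h x \<in> X" if "h \<in> H" "x \<in> X" for h x
    using that act1 actS mem_H_carrier unfolding X_def by auto
  ultimately have "invariant_subspace s (G\<lparr>carrier := H\<rparr>) V \<rho> X"
    using val by (auto simp: invariant_subspace_def X_def)
  moreover have "X \<noteq> {0}"
  proof -
    obtain f where f: "f \<in> S" "f \<noteq> 0" using S I.subspace_0[OF subS] by blast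
    then obtain x where x: "f x \<noteq> 0" by (auto simp: fun_eq_iff)
    then have xG: "x \<in> carrier G" using SU[OF f(1)] by (auto simp: induced_space_def)
    then have "\<tau> (inv x) f \<one> = f x" using induced_apply[OF SU[OF f(1)], of \<one> "inv x"] by simp
    moreover have "\<tau> (inv x) f \<one> \<in> X" using actS[of "inv x" f] f xG by (simp add: X_def)
    ultimately show ?thesis using x by auto
  qed
  ultimately have X: "X = V" using irreducible by (auto simp: irreducible_rep_def)
  have "\<rho> k v = \<rho> \<one> v" if v: "v \<in> V" for v
  proof -
    obtain f where f: "f \<in> S" "v = f \<one>" using v X unfolding X_def by blast
    have "\<rho> k v = v" using act1[OF k(1) f(1)] f k(2) by (simp add: I.kernel_on_def)
    then show ?thesis using R.act_one[OF v] by simp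
  qed
  then have "\<rho> k = \<rho> \<one>"
    using R.act_eq_iff[of k \<one>] k(1) subgroup.one_closed[OF subgroup_H] by simp
  then show ?thesis
    using faithful k(1) subgroup.one_closed[OF subgroup_H] by (simp add: faithful_rep_def inj_on_def)
qed

text \<open>
  The embedding of \<open>V\<close> into the induced space as the functions supported on \<open>H\<close>.
\<close>

definition delta :: "'v \<Rightarrow> 'g \<Rightarrow> 'v" where
  "delta v = (\<lambda>x. if x \<in> H then \<rho> (inv x) v else 0)"

lemma delta_in_U:
  assumes v: "v \<in> V"
  shows "delta v \<in> U"
proof -
  have "\<rho> (inv (x \<otimes> h)) v = \<rho> (inv h) (\<rho> (inv x) v)" if "x \<in> H" "h \<in> H" for x h
    using that v mem_H_carrier by (simp add: G.inv_mult_group rho_mult inv_mem_H)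
  moreover have "x \<otimes> h \<in> H \<longleftrightarrow> x \<in> H" if x: "x \<in> carrier G" and h: "h \<in> H" for x h
  proof
    assume "x \<otimes> h \<in> H"
    then have "x \<otimes> h \<otimes> inv h \<in> H" using inv_mem_H[OF h] by (rule subgroup.m_closed[OF subgroup_H])
    then show "x \<in> H" using x mem_H_carrier[OF h] by (simp add: G.m_assoc)
  qed (use subgroup.m_closed[OF subgroup_H] h in blast)
  moreover have "\<rho> (inv h) 0 = 0" if "h \<in> H" for h using R.act_zero[of "inv h"] inv_mem_H[OF that] by simp
  moreover have "\<rho> (inv x) v \<in> V" if "x \<in> H" for x using R.act_closed[of "inv x" v] inv_mem_H[OF that] v by simp
  ultimately show ?thesis
    using R.subspace_0[OF R.subspace_V] by (auto simp: delta_def induced_space_def mem_H_carrier)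
qed

lemma sum_fun_apply: "(\<Sum>i\<in>I. f i) x = (\<Sum>i\<in>I. f i x)" for f :: "'c \<Rightarrow> 'd \<Rightarrow> 'e::comm_monoid_add"
  by (induction I rule: infinite_finite_induct) auto

lemma orbit_sum_delta:
  assumes L: "subgroup L G" and LH: "L \<inter> H = {\<one>}" and v: "v \<in> V"
  shows "(\<Sum>l\<in>L. \<tau> l (delta v)) \<one> = v"
    and "x \<in> carrier G \<Longrightarrow> x \<notin> L <#> H \<Longrightarrow> (\<Sum>l\<in>L. \<tau> l (delta v)) x = 0"
proof -
  have LG: "l \<in> carrier G" if "l \<in> L" for l using L that by (rule subgroup.mem_carrier)
  have app: "(\<Sum>l\<in>L. \<tau> l (delta v)) x = (\<Sum>l\<in>L. delta v (inv l \<otimes> x))" if "x \<in> carrier G" for x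
    by (simp add: sum_fun_apply induced_apply[OF delta_in_U[OF v] that])
  have finL: "finite L" using subgroup.subset[OF L] finite_carrier by (rule finite_subset)
  have "delta v (inv l \<otimes> \<one>) = (if l = \<one> then v else 0)" if l: "l \<in> L" for l
  proof -
    have "inv l \<in> L" using subgroup.m_inv_closed[OF L l] .
    then have "inv l \<in> H \<longleftrightarrow> inv l = \<one>"
      using LH by blast
    then have "inv l \<in> H \<longleftrightarrow> l = \<one>" using LG[OF l] by simp
    then show ?thesis using LG[OF l] R.act_one[OF v] by (simp add: delta_def)
  qed
  then show "(\<Sum>l\<in>L. \<tau> l (delta v)) \<one> = v"
    using app[of \<one>] finL subgroup.one_closed[OF L] by simp
  assume x: "x \<in> carrier G" "x \<notin> L <#> H"
  have "inv l \<otimes> x \<notin> H" if l: "l \<in> L" for l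
  proof
    assume "inv l \<otimes> x \<in> H"
    moreover have "x = l \<otimes> (inv l \<otimes> x)" using LG[OF l] x(1) by (simp flip: G.m_assoc)
    ultimately show False using l x(2) unfolding set_mult_def by blast
  qed
  then show "(\<Sum>l\<in>L. \<tau> l (delta v)) x = 0" using app[OF x(1)] by (simp add: delta_def)
qed

text \<open>
  Expanding the product of the \<open>1 - n D\<close> gives a signed sum of translates of \<open>f\<close> by products of distinct
  \<open>n D\<close>. By assumption only the empty product contributes at \<open>x\<close>.
\<close>

lemma diff_op_apply:
  assumes f: "f \<in> U" and n: "\<And>D. D \<in> set Ds \<Longrightarrow> n D \<in> carrier G" and "distinct Ds" and "x \<in> carrier G"
    and "\<And>Es. distinct Es \<Longrightarrow> Es \<noteq> [] \<Longrightarrow> set Es \<subseteq> set Ds \<Longrightarrow> f (inv (list_mult G (map n Es)) \<otimes> x) = 0"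
  shows "I.diff_op (map n Ds) f x = f x"
  using assms(2-)
proof (induction Ds arbitrary: x)
  case (Cons D Ds)
  have nD: "n D \<in> carrier G" and nDs: "set (map n Ds) \<subseteq> carrier G" and x: "x \<in> carrier G"
    using Cons.prems by auto
  have mem: "I.diff_op (map n Ds) f \<in> U"
    using I.diff_op_closed[OF nDs I.invariant_subspace_whole f] .
  have 1: "I.diff_op (map n Ds) f x = f x"
    using Cons.prems by (intro Cons.IH) auto
  have "I.diff_op (map n Ds) f (inv (n D) \<otimes> x) = f (inv (n D) \<otimes> x)"
  proof (rule Cons.IH)
    fix Es assume Es: "distinct Es" "Es \<noteq> []" "set Es \<subseteq> set Ds"
    have "list_mult G (map n Es) \<in> carrier G" using Es nDs by (intro G.list_mult_closed) auto
    then have "inv (list_mult G (map n Es)) \<otimes> (inv (n D) \<otimes> x) = inv (list_mult G (map n (D # Es))) \<otimes> x"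
      using nD x by (simp add: G.inv_mult_group G.m_assoc)
    moreover have "f (inv (list_mult G (map n (D # Es))) \<otimes> x) = 0"
      using Cons.prems(2) Es by (intro Cons.prems(4)) auto
    ultimately show "f (inv (list_mult G (map n Es)) \<otimes> (inv (n D) \<otimes> x)) = 0" by simp
  qed (use Cons.prems in auto)
  also have "f (inv (n D) \<otimes> x) = 0" using Cons.prems(4)[of "[D]"] nD by simp
  finally show ?case using 1 induced_apply[OF mem x, of "n D"] by simp
qed simp

text \<open>
  The order \<open>n\<close> of \<open>x\<close> divides that of \<open>G\<close> and is invertible in the field, so \<open>x\<close> acts as a primitive
  \<open>n\<close>-th root of unity and \<open>y\<close> as another \<open>n\<close>-th root of unity.
\<close>

lemma central_comparable:
  assumes char: "of_nat (order G) \<noteq> (0::'f)"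
    and x: "x \<in> group_center (G\<lparr>carrier := H\<rparr>)" and y: "y \<in> group_center (G\<lparr>carrier := H\<rparr>)"
    and eq: "y [^] G.ord x = \<one>"
  shows "\<exists>m::nat. y = x [^] m"
proof -
  have xG: "x \<in> carrier G" using x mem_H_carrier by (simp add: group_center_def)
  have pow: "z [^]\<^bsub>G\<lparr>carrier := H\<rparr>\<^esub> (i::nat) = z [^] i" for z i
    by (rule G.nat_pow_consistent[symmetric])
  have "G.ord x dvd order G" using G.ord_dvd_group_order[OF xG] .
  then have "of_nat (G.ord x) \<noteq> (0::'f)" using char by (auto simp: dvd_def)
  then have "\<exists>m::nat. y = x [^]\<^bsub>G\<lparr>carrier := H\<rparr>\<^esub> m"
    using eq G.pow_eq_id[OF xG] nat_dvd_not_less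
    by (intro central_root_of_unity_is_power[OF irreducible faithful x _ _ y, of "G.ord x"])
      (auto simp: pow xG)
  then show ?thesis by (simp add: pow)
qed

text \<open>
  The sum \<open>f\<close> of the translates by \<open>L\<close> of a vector in \<open>V\<close> is the test vector: it is fixed by \<open>L\<close>,
  supported on \<open>L H\<close>, and its value at \<open>\<one>\<close> is not changed by the product of the \<open>1 - n D\<close>.
\<close>

proposition exists_center_preserving_constituent:
  assumes char: "of_nat (order G) \<noteq> (0::'f)"
  shows "\<exists>W. irreducible_constituent (fun_scale s) G U \<tau> W \<and>
    center_preserving_on G (GL (fun_scale s) W) (subrep \<tau> W) H"
proof -
  define small where "small = {N. N \<lhd> G \<and> N \<inter> H = {\<one>} \<and>
    (\<forall>h\<in>H. h \<notin> group_center G \<longrightarrow> (\<exists>g\<in>carrier G. commutator G g h \<notin> N))}"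
  have fin_normal: "finite {N. N \<lhd> G}"
    by (rule finite_subset[of _ "Pow (carrier G)"])
      (use finite_carrier in \<open>auto dest!: normal_imp_subgroup subgroup.subset\<close>)
  have "finite small" using fin_normal by (rule rev_finite_subset) (auto simp: small_def)
  moreover have "{\<one>} \<in> small"
  proof -
    have "{\<one>} \<lhd> G" by (simp add: G.normal_inv_iff G.triv_subgroup)
    moreover have "\<exists>g\<in>carrier G. commutator G g h \<notin> {\<one>}" if "h \<in> H" "h \<notin> group_center G" for h
      using that G.mem_group_center_iff[OF mem_H_carrier[OF that(1)]] by blast
    ultimately show ?thesis using subgroup.one_closed[OF subgroup_H] unfolding small_def by blast
  qed
  ultimately have "\<exists>L\<in>small. \<forall>N\<in>small. L \<subseteq> N \<longrightarrow> L = N"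
    by (intro finite_has_maximal) auto
  then obtain L where L: "L \<in> small" and L_max: "\<forall>N\<in>small. L \<subseteq> N \<longrightarrow> L = N" ..
  have L_normal: "L \<lhd> G" and LH: "L \<inter> H = {\<one>}"
    and L_small: "\<And>h. h \<in> H \<Longrightarrow> h \<notin> group_center G \<Longrightarrow> \<exists>g\<in>carrier G. commutator G g h \<notin> L"
    using L by (simp_all add: small_def)
  interpret L: normal L G by (rule L_normal)
  define above where "above = {D. D \<lhd> G \<and> L \<subset> D \<and> D \<inter> H = {\<one>}}"
  define M where "M = {D \<in> above. \<forall>E\<in>above. E \<subseteq> D \<longrightarrow> E = D}"
  have fin_above: "finite above" using fin_normal by (rule rev_finite_subset) (auto simp: above_def)
  have below: "\<exists>D\<in>M. D \<subseteq> N" if N: "N \<in> above" for N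
  proof -
    have "\<exists>D\<in>{E \<in> above. E \<subseteq> N}. \<forall>E\<in>{E \<in> above. E \<subseteq> N}. E \<subseteq> D \<longrightarrow> D = E"
      by (rule finite_has_minimal) (use fin_above N in auto)
    then obtain D where D: "D \<in> above" "D \<subseteq> N" and min: "\<And>E. E \<in> above \<Longrightarrow> E \<subseteq> N \<Longrightarrow> E \<subseteq> D \<Longrightarrow> D = E"
      by auto
    have "E = D" if "E \<in> above" "E \<subseteq> D" for E
      using min[OF that(1) order_trans[OF that(2) D(2)] that(2)] ..
    then have "D \<in> M" using D(1) by (simp add: M_def)
    then show ?thesis using D(2) ..
  qed
  have "\<exists>n. (\<forall>D\<in>M. n D \<in> D) \<and>
      (\<forall>Ds. distinct Ds \<longrightarrow> Ds \<noteq> [] \<longrightarrow> set Ds \<subseteq> M \<longrightarrow> list_mult G (map n Ds) \<notin> L <#> H)"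
  proof (rule G.separating_elements[OF finite_carrier subgroup_H central_comparable[OF char] L_normal L_small])
    show "\<exists>h\<in>H. h \<notin> group_center G \<and> (\<forall>g\<in>carrier G. commutator G g h \<in> D)"
      if D: "D \<lhd> G" "L \<subset> D" "D \<inter> H = {\<one>}" for D
    proof (rule ccontr)
      assume not: "\<not> ?thesis"
      have "\<exists>g\<in>carrier G. commutator G g h \<notin> D" if "h \<in> H" "h \<notin> group_center G" for h
        using not that by blast
      then have "D \<in> small" using D by (simp add: small_def)
      then show False using L_max D(2) by auto
    qed
    show "D \<lhd> G \<and> L \<subset> D \<and> D \<inter> H = {\<one>} \<and> (\<forall>E. E \<lhd> G \<longrightarrow> L \<subset> E \<longrightarrow> E \<subseteq> D \<longrightarrow> E = D)"
      if D: "D \<in> M" for D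
    proof -
      have Da: "D \<lhd> G" "L \<subset> D" "D \<inter> H = {\<one>}" and min: "\<forall>E\<in>above. E \<subseteq> D \<longrightarrow> E = D"
        using D by (simp_all add: M_def above_def)
      have "E \<in> above" if "E \<lhd> G" "L \<subset> E" "E \<subseteq> D" for E
      proof -
        have "E \<inter> H = {\<one>}" using that(2,3) Da(3) LH by blast
        then show ?thesis using that by (simp add: above_def)
      qed
      then show ?thesis using Da min by simp
    qed
  qed
  then obtain n where nsep: "(\<forall>D\<in>M. n D \<in> D) \<and>
      (\<forall>Ds. distinct Ds \<longrightarrow> Ds \<noteq> [] \<longrightarrow> set Ds \<subseteq> M \<longrightarrow> list_mult G (map n Ds) \<notin> L <#> H)" ..
  then have n: "n D \<in> D" if "D \<in> M" for D using that by simp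
  have sep: "list_mult G (map n Ds) \<notin> L <#> H" if "distinct Ds" "Ds \<noteq> []" "set Ds \<subseteq> M" for Ds
    using nsep that by simp
  have "finite M" using fin_above by (simp add: M_def)
  then obtain Ds where Ds: "set Ds = M" "distinct Ds" using finite_distinct_list by blast
  have MD: "D \<lhd> G \<and> L \<subseteq> D \<and> n D \<in> D" if "D \<in> set Ds" for D
    using that n[of D] Ds by (auto simp: M_def above_def)
  have nG: "n D \<in> carrier G" if "D \<in> set Ds" for D
    using MD[OF that] subgroup.mem_carrier[OF normal_imp_subgroup, of D G "n D"] by simp
  have "V \<noteq> {0}" using irreducible by (simp add: irreducible_rep_def)
  then obtain v where v: "v \<in> V" "v \<noteq> 0" using R.subspace_0[OF R.subspace_V] by blast
  define f where "f = (\<Sum>l\<in>L. \<tau> l (delta v))"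
  have f1: "f \<one> = v"
    unfolding f_def by (rule orbit_sum_delta(1)[OF L.subgroup_axioms LH v(1)])
  have f0: "f x = 0" if "x \<in> carrier G" "x \<notin> L <#> H" for x
    unfolding f_def by (rule orbit_sum_delta(2)[OF L.subgroup_axioms LH v(1) that])
  have fL: "f \<in> I.fixed_space L"
    unfolding f_def by (rule I.orbit_sum_in_fixed_space[OF L.subgroup_axioms delta_in_U[OF v(1)]])
  have "I.diff_op (map n Ds) f \<one> = f \<one>"
  proof (rule diff_op_apply)
    show "f \<in> U" using fL by (simp add: I.fixed_space_def)
    fix Es assume Es: "distinct Es" "Es \<noteq> []" "set Es \<subseteq> set Ds"
    define t where "t = list_mult G (map n Es)"
    have tG: "t \<in> carrier G" unfolding t_def using nG Es by (intro G.list_mult_closed) auto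
    have "inv t \<notin> L <#> H"
    proof
      assume "inv t \<in> L <#> H"
      then obtain l h where lh: "l \<in> L" "h \<in> H" "inv t = l \<otimes> h" by (auto simp: set_mult_def)
      have hG: "h \<in> carrier G" and lG: "l \<in> carrier G" using lh mem_H_carrier by auto
      have "t = inv (l \<otimes> h)" using G.inv_inv[OF tG] lh(3) by simp
      also have "\<dots> = (inv h \<otimes> inv l \<otimes> h) \<otimes> inv h" using hG lG by (simp add: G.inv_mult_group G.m_assoc)
      also have "\<dots> \<in> L <#> H"
      proof -
        have "inv l \<in> L" using subgroup.m_inv_closed[OF L.subgroup_axioms lh(1)] .
        then have "inv h \<otimes> inv l \<otimes> h \<in> L" by (rule L.inv_op_closed1[OF hG])
        then show ?thesis using inv_mem_H[OF lh(2)] unfolding set_mult_def by blast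
      qed
      finally show False using sep[OF Es(1,2)] Es(3) Ds(1) by (simp add: t_def)
    qed
    then show "f (inv (list_mult G (map n Es)) \<otimes> \<one>) = 0" using f0[of "inv t"] tG by (simp add: t_def)
  qed (use nG Ds in auto)
  then have "I.diff_op (map n Ds) f \<noteq> 0" using f1 v by auto
  then have "\<exists>S. irreducible_constituent (fun_scale s) G U \<tau> S \<and> S \<subseteq> I.fixed_space L \<and>
      (\<forall>D\<in>set Ds. \<not> S \<subseteq> I.fixed_space D)"
    by (intro I.exists_constituent_avoiding[OF finite_carrier char L_normal _ fL, of Ds n] MD)
  then obtain S where S: "irreducible_constituent (fun_scale s) G U \<tau> S" "S \<subseteq> I.fixed_space L"
      "\<forall>D\<in>M. \<not> S \<subseteq> I.fixed_space D"
    unfolding Ds(1) by (elim exE conjE)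
  have inv: "invariant_subspace (fun_scale s) G U \<tau> S" and S0: "S \<noteq> {0}"
    and rep: "linear_rep (fun_scale s) G S (subrep \<tau> S)"
    using S(1) by (auto simp: irreducible_constituent_def irreducible_rep_def)
  have SU: "S \<subseteq> U" using inv by (simp add: invariant_subspace_def)
  let ?K = "I.kernel_on S"
  have "h \<in> group_center G" if h: "h \<in> hom_center G (GL (fun_scale s) S) (subrep \<tau> S)" "h \<in> H" for h
  proof (rule ccontr)
    assume noncentral: "h \<notin> group_center G"
    have K: "?K \<lhd> G" by (rule I.normal_kernel_on[OF inv])
    have "commutator G g h \<in> ?K" if g: "g \<in> carrier G" for g
      using linear_rep.commutator_acts_trivially[OF rep h(1) g] g mem_H_carrier[OF h(2)]
      by (simp add: I.kernel_on_def subrep_def)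
    moreover obtain g where "g \<in> carrier G" "commutator G g h \<notin> L"
      using L_small[OF h(2) noncentral] by blast
    moreover have "L \<subseteq> ?K" using S(2) by (auto simp: I.kernel_on_def I.fixed_space_def)
    moreover have "?K \<inter> H = {\<one>}"
      using restriction_faithful[OF inv S0] LH \<open>L \<subseteq> ?K\<close> by blast
    \<comment> \<open>\<open>?K\<close> is strictly larger than \<open>L\<close> because it contains \<open>[g, h]\<close>\<close>
    ultimately have "?K \<in> above" using K unfolding above_def by blast
    then obtain D where D: "D \<in> M" "D \<subseteq> ?K" using below by blast
    then have "S \<subseteq> I.fixed_space D" using SU by (auto simp: I.kernel_on_def I.fixed_space_def)
    then show False using S(3) D(1) by blast
  qed
  then have "center_preserving_on G (GL (fun_scale s) S) (subrep \<tau> S) H"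
    unfolding center_preserving_on_def by (intro subsetI) (elim IntE)
  then show ?thesis using S(1) by (intro exI conjI)
qed

end

theorem theorem1p2:
  fixes G :: "('g, 'b) monoid_scheme"
    and H :: "'g set"
    and s :: "'f::field \<Rightarrow> 'v::ab_group_add \<Rightarrow> 'v"
    and V :: "'v set"
    and \<rho> :: "'g \<Rightarrow> 'v \<Rightarrow> 'v"
  assumes "group G" and "finite (carrier G)"
    and "subgroup H G"
    and "\<not> CHAR('f) dvd order G"
    and "irreducible_rep s (G\<lparr>carrier := H\<rparr>) V \<rho>"
    and "faithful_rep (G\<lparr>carrier := H\<rparr>) \<rho>"
  shows "\<exists>W. irreducible_constituent (fun_scale s) G
               (induced_space G H V \<rho>) (induced_rep G H V \<rho>) W \<and>
             center_preserving_on G (GL (fun_scale s) W) (subrep (induced_rep G H V \<rho>) W) H"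
proof -
  have "linear_rep s (G\<lparr>carrier := H\<rparr>) V \<rho>" using assms(5) by (simp add: irreducible_rep_def)
  then have "faithful_induction s G H V \<rho>"
    using assms by (simp add: faithful_induction_def faithful_induction_axioms_def)
  then show ?thesis
    using assms(4) by (intro faithful_induction.exists_center_preserving_constituent) (simp_all add: of_nat_eq_0_iff_char_dvd)
qed

end
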